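(* Let $p_1\le p_2\le p_3$ be elements of $\{3,4,5,\dots\}\cup\{\infty\}$ and $r_k=\cos(\pi/p_k)$ (with $\pi/\infty=0$). If $$r_1^2+r_2^2+r_3^2=1+2r_1r_2r_3\quad\text{and}\quad r_1r_2r_3\ge\frac{13+\sqrt{297}}{32}\approx0.9448,$$ then the $(p_1,p_2,p_3)$-triangle group is of type B. For instance, the triples $(p,p,\infty)$ with $p\ge14$ and the triples $(p,2p,2p)$ with $p\ge12$ are of type B.
   Context: $\mathbb C^{2,1}$ is $\mathbb C^3$ with the Hermitian form $\langle z,w\rangle=z_1\bar w_1+z_2\bar w_2-z_3\bar w_3$. The complex hyperbolic plane $H^2_{\mathbb C}$ is the projectivisation of the set of vectors with $\langle z,z\rangle<0$; its ideal boundary is the projectivisation of the set of nonzero null vectors; its holomorphic isometry group is $\mathrm{PU}(2,1)$. A complex geodesic $C$ is the projectivisation (intersected with $H^2_{\mathbb C}$) of the orthogonal complement of a vector $c$ with $\langle c,c\rangle>0$; $c$ is called a polar vector of $C$, normalised if $\langle c,c\rangle=1$. Two complex geodesics with normalised polar vectors $c,c'$ meet in $H^2_{\mathbb C}$ at angle $\varphi\in(0,\pi/2]$ iff $|\langle c,c'\rangle|=\cos\varphi<1$; distinct complex geodesics have closures meeting in one point of the ideal boundary ("angle $0$") iff $|\langle c,c'\rangle|=1$. A complex hyperbolic triangle is a triple $(C_1,C_2,C_3)$ of complex geodesics, with normalised polar vectors $c_k$ (indices mod 3). It is a $(p_1,p_2,p_3)$-triangle if $C_{k-1}$ and $C_{k+1}$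 meet at angle $\pi/p_k$ for each $k$, so $|\langle c_{k-1},c_{k+1}\rangle|=r_k=\cos(\pi/p_k)$. Its angular invariant is $\alpha=\arg\left(\prod_{k=1}^3\langle c_{k-1},c_{k+1}\rangle\right)$. The complex reflection in $C_k$ is $\iota_k(z)=-z+2\langle z,c_k\rangle c_k$, and the triangle group is generated by $\iota_1,\iota_2,\iota_3$. For fixed $(p_1,p_2,p_3)$ these groups are parameterised, up to conjugation, by $t=\cot(\alpha/2)\in(-t_\infty,t_\infty)$, where $t_\infty=\sqrt{(1+c_\infty)/(1-c_\infty)}$, $c_\infty=\frac{r_1^2+r_2^2+r_3^2-1}{2r_1r_2r_3}$; under the identity $r_1^2+r_2^2+r_3^2=1+2r_1r_2r_3$ one has $c_\infty=1$ and $t_\infty=+\infty$, so $t$ ranges over all of $\mathbb R$. The value $t=0$ corresponds to the triangle lying in a real slice, and $t$ and $-t$ give groups conjugate by an antiholomorphic isometry. Put $w_A=\iota_3\iota_2\iota_3\iota_1$ and $w_B=\iota_1\iota_2\iota_3$. An isometry is elliptic if it has a fixed point in $H^2_{\mathbb C}$. The triple (or the triangle group) is of type A if $w_A$ becomes elliptic before $w_B$ as $t$ increases from $0$, i.e. if $\inf\{t\ge0: w_A\text{ is elliptic}\}<\inf\{t\ge0: w_B\text{ is elliptic}\}$ (with $\inf\emptyset=+\infty$); otherwise it is of type B. *)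

theory Defs
  imports "HOL-Analysis.Analysis" "HOL-Library.Extended_Nat" "HOL-Library.Extended_Real"
begin

definition herm :: "complex^3 \<Rightarrow> complex^3 \<Rightarrow> complex" where
  "herm z w = z$1 * cnj (w$1) + z$2 * cnj (w$2) - z$3 * cnj (w$3)"

(* A point of the complex projective plane is represented by the complex line it stands for
   (vec.span is the span over the complex scalars), so that a linear map acts on points by
   taking images. *)

definition complex_hyperbolic_plane :: "(complex^3) set set" where
  "complex_hyperbolic_plane = {vec.span {z} |z. Re (herm z z) < 0}"

definition ideal_boundary :: "(complex^3) set set" where
  "ideal_boundary = {vec.span {z} |z. z \<noteq> 0 \<and> herm z z = 0}"

definition polar_vector :: "(complex^3) set set \<Rightarrow> complex^3 \<Rightarrow> bool" where
  "polar_vector C c \<longleftrightarrow> Re (herm c c) > 0 \<and>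
     C = {L \<in> complex_hyperbolic_plane. \<forall>z\<in>L. herm z c = 0}"

definition complex_geodesic :: "(complex^3) set set \<Rightarrow> bool" where
  "complex_geodesic C \<longleftrightarrow> (\<exists>c. polar_vector C c)"

definition normalised_polar_vector :: "(complex^3) set set \<Rightarrow> complex^3 \<Rightarrow> bool" where
  "normalised_polar_vector C c \<longleftrightarrow> polar_vector C c \<and> herm c c = 1"

(* The ideal points in the closure of a complex geodesic: the null lines in the orthogonal
   complement of its polar vectors. *)
definition ideal_points :: "(complex^3) set set \<Rightarrow> (complex^3) set set" where
  "ideal_points C = {L \<in> ideal_boundary. \<exists>c. polar_vector C c \<and> (\<forall>z\<in>L. herm z c = 0)}"

definition meet_at_angle :: "(complex^3) set set \<Rightarrow> (complex^3) set set \<Rightarrow> real \<Rightarrow> bool" where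
  "meet_at_angle C C' \<phi> \<longleftrightarrow>
     complex_geodesic C \<and> complex_geodesic C' \<and> C \<noteq> C' \<and>
     (if \<phi> = 0 then \<exists>!L. L \<in> ideal_points C \<inter> ideal_points C'
      else 0 < \<phi> \<and> \<phi> \<le> pi / 2 \<and> C \<inter> C' \<noteq> {} \<and>
        (\<exists>c c'. normalised_polar_vector C c \<and> normalised_polar_vector C' c' \<and>
                cmod (herm c c') = cos \<phi>))"

definition pi_over :: "enat \<Rightarrow> real" where
  "pi_over p = (case p of enat n \<Rightarrow> pi / real n | \<infinity> \<Rightarrow> 0)"

definition cos_pi_over :: "enat \<Rightarrow> real" where
  "cos_pi_over p = cos (pi_over p)"

definition triangle ::
  "enat \<Rightarrow> enat \<Rightarrow> enat \<Rightarrow>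
   (complex^3) set set \<Rightarrow> (complex^3) set set \<Rightarrow> (complex^3) set set \<Rightarrow> bool" where
  "triangle p1 p2 p3 C1 C2 C3 \<longleftrightarrow>
     complex_geodesic C1 \<and> complex_geodesic C2 \<and> complex_geodesic C3 \<and>
     meet_at_angle C3 C2 (pi_over p1) \<and>
     meet_at_angle C1 C3 (pi_over p2) \<and>
     meet_at_angle C2 C1 (pi_over p3)"

(* The three factors are those of index k = 1, 2, 3 (mod 3); the product does not change when
   the normalised polar vectors are multiplied by unit scalars. *)
definition angular_invariant :: "complex^3 \<Rightarrow> complex^3 \<Rightarrow> complex^3 \<Rightarrow> real" where
  "angular_invariant c1 c2 c3 = Arg (herm c3 c2 * herm c1 c3 * herm c2 c1)"

definition complex_reflection :: "complex^3 \<Rightarrow> complex^3 \<Rightarrow> complex^3" where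
  "complex_reflection c z = - z + (2 * herm z c) *s c"

definition word_A :: "complex^3 \<Rightarrow> complex^3 \<Rightarrow> complex^3 \<Rightarrow> complex^3 \<Rightarrow> complex^3" where
  "word_A c1 c2 c3 = complex_reflection c3 \<circ> complex_reflection c2 \<circ> complex_reflection c3 \<circ> complex_reflection c1"

definition word_B :: "complex^3 \<Rightarrow> complex^3 \<Rightarrow> complex^3 \<Rightarrow> complex^3 \<Rightarrow> complex^3" where
  "word_B c1 c2 c3 = complex_reflection c1 \<circ> complex_reflection c2 \<circ> complex_reflection c3"

definition elliptic :: "(complex^3 \<Rightarrow> complex^3) \<Rightarrow> bool" where
  "elliptic f \<longleftrightarrow> (\<exists>L \<in> complex_hyperbolic_plane. f ` L = L)"

definition c_inf :: "enat \<Rightarrow> enat \<Rightarrow> enat \<Rightarrow> real" where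
  "c_inf p1 p2 p3 =
     ((cos_pi_over p1)\<^sup>2 + (cos_pi_over p2)\<^sup>2 + (cos_pi_over p3)\<^sup>2 - 1) /
     (2 * cos_pi_over p1 * cos_pi_over p2 * cos_pi_over p3)"

(* Triangles with angular invariant \<alpha> whose polar vectors are a basis exist iff
   cos \<alpha> < c_inf; for c_inf \<ge> 1 this does not bound t = cot (\<alpha> / 2). *)
definition t_inf :: "enat \<Rightarrow> enat \<Rightarrow> enat \<Rightarrow> ereal" where
  "t_inf p1 p2 p3 =
     (if c_inf p1 p2 p3 \<ge> 1 then \<infinity>
      else ereal (sqrt ((1 + c_inf p1 p2 p3) / (1 - c_inf p1 p2 p3))))"

(* Polar vectors of a triangle with parameter t.  The case \<alpha> = 0 corresponds to t = \<infinity> and is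
   excluded explicitly, because cot 0 = 0 in HOL. *)
definition triangle_with_parameter ::
  "enat \<Rightarrow> enat \<Rightarrow> enat \<Rightarrow> real \<Rightarrow> complex^3 \<Rightarrow> complex^3 \<Rightarrow> complex^3 \<Rightarrow> bool" where
  "triangle_with_parameter p1 p2 p3 t c1 c2 c3 \<longleftrightarrow>
     (\<exists>C1 C2 C3. triangle p1 p2 p3 C1 C2 C3 \<and>
        normalised_polar_vector C1 c1 \<and> normalised_polar_vector C2 c2 \<and>
        normalised_polar_vector C3 c3) \<and>
     angular_invariant c1 c2 c3 \<noteq> 0 \<and> t = cot (angular_invariant c1 c2 c3 / 2) \<and>
     - t_inf p1 p2 p3 < ereal t \<and> ereal t < t_inf p1 p2 p3"

(* The triangle with a given parameter is unique up to conjugation, so it does not matter which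
   one is used to decide whether a word is elliptic. *)
definition elliptic_parameters ::
  "enat \<Rightarrow> enat \<Rightarrow> enat \<Rightarrow>
   (complex^3 \<Rightarrow> complex^3 \<Rightarrow> complex^3 \<Rightarrow> complex^3 \<Rightarrow> complex^3) \<Rightarrow> real set" where
  "elliptic_parameters p1 p2 p3 w =
     {t. t \<ge> 0 \<and> (\<exists>c1 c2 c3. triangle_with_parameter p1 p2 p3 t c1 c2 c3 \<and>
                     elliptic (w c1 c2 c3))}"

definition type_A :: "enat \<Rightarrow> enat \<Rightarrow> enat \<Rightarrow> bool" where
  "type_A p1 p2 p3 \<longleftrightarrow>
     Inf (ereal ` elliptic_parameters p1 p2 p3 word_A) <
     Inf (ereal ` elliptic_parameters p1 p2 p3 word_B)"

definition type_B :: "enat \<Rightarrow> enat \<Rightarrow> enat \<Rightarrow> bool" where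
  "type_B p1 p2 p3 \<longleftrightarrow> \<not> type_A p1 p2 p3"

end

theory Submission
  imports Defs "HOL-Computational_Algebra.Fundamental_Theorem_Algebra"
begin

text \<open>Let \<open>R = r1 r2 r3\<close> and measure the parameter by \<open>x = R (1 - cos \<alpha>)\<close>, which decreases as \<open>t \<ge> 0\<close>
  increases. The word \<open>w_A\<close> is a product of two complex reflections, in \<open>c1\<close> and in
  \<open>\<iota>3 c2\<close>; if it is elliptic, then \<open>|\<langle>c1, \<iota>3 c2\<rangle>| < 1\<close>, which forces \<open>x < R (1 - R)\<close>.
  The trace of \<open>w_B\<close> is \<open>\<tau> = -1 - 8 R + 8 R exp (i \<alpha>)\<close>, and Goldman's discriminant of its
  characteristic polynomial \<open>X^3 - \<tau> X^2 + cnj \<tau> X - 1\<close> is \<open>256 x g(x)\<close> with the quadratic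
  \<open>g(x) = 64 x^2 + (64 R^2 - 80 R + 13) x + 2 (1 - R)\<close>. Where \<open>g < 0\<close> the eigenvalues are distinct
  and unimodular, so \<open>w_B\<close> is elliptic. The bound on \<open>R\<close> says exactly that \<open>g \<le> 0\<close> at
  \<open>R (1 - R)\<close>, so every \<open>t\<close> with \<open>w_A\<close> elliptic is preceded by one with \<open>w_B\<close> elliptic.\<close>

section \<open>The Hermitian form\<close>

lemma herm_add_left: "herm (x + y) w = herm x w + herm y w"
  and herm_add_right: "herm w (x + y) = herm w x + herm w y"
  and herm_diff_left: "herm (x - y) w = herm x w - herm y w"
  and herm_diff_right: "herm w (x - y) = herm w x - herm w y"
  and herm_minus_left: "herm (- x) w = - herm x w"
  and herm_minus_right: "herm w (- x) = - herm w x"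
  and herm_scale_left: "herm (k *s x) w = k * herm x w"
  and herm_scale_right: "herm w (k *s x) = cnj k * herm w x"
  and herm_zero_left: "herm 0 w = 0"
  by (simp_all add: herm_def algebra_simps)

lemmas herm_linear = herm_add_left herm_add_right herm_diff_left herm_diff_right
  herm_minus_left herm_minus_right herm_scale_left herm_scale_right herm_zero_left

lemma cnj_herm: "cnj (herm z w) = herm w z"
  by (simp add: herm_def algebra_simps)

lemma herm_eq_0_commute: "herm z w = 0 \<longleftrightarrow> herm w z = 0"
  by (metis cnj_herm complex_cnj_zero_iff)

lemma herm_self: "herm z z = complex_of_real (Re (herm z z))"
  by (simp add: complex_eq_iff herm_def algebra_simps)

lemma mult_cnj_cmod: "z * cnj z = (complex_of_real (cmod z))\<^sup>2"
  by (metis complex_norm_square of_real_power)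

lemma cmod_eq_1_of_mult_cnj:
  assumes "z * cnj z = 1" shows "cmod z = 1"
proof -
  have "complex_of_real ((cmod z)\<^sup>2) = of_real 1" using assms by (simp add: mult_cnj_cmod)
  then have "(cmod z)\<^sup>2 = 1" unfolding of_real_eq_iff .
  then show ?thesis using power2_eq_imp_eq[of "cmod z" 1] by simp
qed

lemma Re_herm_self: "Re (herm z z) = (cmod (z$1))\<^sup>2 + (cmod (z$2))\<^sup>2 - (cmod (z$3))\<^sup>2"
  by (simp add: herm_def cmod_def power2_eq_square)

text \<open>Pythagoras for orthogonal vectors. It is used for \<open>d$3 *s z - z$3 *s d\<close>,
  which cancels the third entries, and for small perturbations of a negative vector.\<close>

lemma Re_herm_combination:
  assumes "herm d z = 0"
  shows "Re (herm (p *s z - q *s d) (p *s z - q *s d)) =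
    (cmod p)\<^sup>2 * Re (herm z z) + (cmod q)\<^sup>2 * Re (herm d d)"
proof -
  have "herm z d = 0" using assms herm_eq_0_commute by blast
  then have "herm (p *s z - q *s d) (p *s z - q *s d) =
     (p * cnj p) * herm z z + (q * cnj q) * herm d d"
    using assms by (simp add: herm_linear algebra_simps)
  also have "\<dots> = of_real ((cmod p)\<^sup>2 * Re (herm z z) + (cmod q)\<^sup>2 * Re (herm d d))"
    using herm_self[of z] herm_self[of d] by (simp add: mult_cnj_cmod)
  finally show ?thesis by (simp only: Re_complex_of_real)
qed

text \<open>The vector \<^term>\<open>d$3 *s z - z$3 *s d\<close> has vanishing third entry, so the form is nonnegative
  on it; this replaces Sylvester's law of inertia.\<close>

lemma herm_pos_of_orthogonal_negative:
  assumes "Re (herm z z) < 0" "herm d z = 0" "d \<noteq> 0"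
  shows "Re (herm d d) > 0"
proof (cases "d$3 = 0")
  case True
  then have "d$1 \<noteq> 0 \<or> d$2 \<noteq> 0"
    using assms(3) by (auto simp: vec_eq_iff forall_3)
  then have "(cmod (d$1))\<^sup>2 + (cmod (d$2))\<^sup>2 > 0"
    by (auto simp: sum_power2_gt_zero_iff)
  then show ?thesis using True by (simp add: Re_herm_self)
next
  case False
  define w where "w = d$3 *s z - z$3 *s d"
  have "w$3 = 0" by (simp add: w_def)
  then have "Re (herm w w) \<ge> 0" by (simp add: Re_herm_self)
  then have *: "(cmod (d$3))\<^sup>2 * Re (herm z z) + (cmod (z$3))\<^sup>2 * Re (herm d d) \<ge> 0"
    unfolding w_def using Re_herm_combination[OF assms(2)] by simp
  have "(cmod (d$3))\<^sup>2 * Re (herm z z) < 0"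
    using False assms(1) by (simp add: mult_pos_neg)
  with * have "(cmod (z$3))\<^sup>2 * Re (herm d d) > 0" by linarith
  then show ?thesis by (simp add: zero_less_mult_iff)
qed

lemma null_third_nonzero:
  assumes "herm z z = 0" "z \<noteq> 0"
  shows "z$3 \<noteq> 0"
proof
  assume z: "z$3 = 0"
  have "Re (herm z z) = 0" using assms by simp
  then have "(cmod (z$1))\<^sup>2 + (cmod (z$2))\<^sup>2 = 0" using z by (simp add: Re_herm_self)
  then have "z$1 = 0 \<and> z$2 = 0" by (simp add: sum_power2_eq_zero_iff)
  then show False using z assms(2) by (auto simp: vec_eq_iff forall_3)
qed

text \<open>The combination of \<open>d\<close> and \<open>z\<close> without third entry is null,
  and the form is positive definite on vectors with vanishing third entry, so the combination is
  0.\<close>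

lemma orthogonal_null_proportional:
  assumes "herm z z = 0" "z \<noteq> 0" "herm d d = 0" "herm d z = 0"
  shows "\<exists>k. d = k *s z"
proof -
  define w where "w = d$3 *s z - z$3 *s d"
  have z3: "z$3 \<noteq> 0" by (rule null_third_nonzero[OF assms(1,2)])
  have "Re (herm w w) = 0"
    unfolding w_def Re_herm_combination[OF assms(4)] using assms by simp
  moreover have w3: "w$3 = 0" by (simp add: w_def)
  ultimately have "(cmod (w$1))\<^sup>2 + (cmod (w$2))\<^sup>2 = 0" by (simp add: Re_herm_self)
  then have "w$1 = 0 \<and> w$2 = 0" by (simp add: sum_power2_eq_zero_iff)
  with w3 have "\<forall>i. d$3 * z$i = z$3 * d$i" by (simp add: w_def forall_3)
  then have "d = (d$3 / z$3) *s z"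
    using z3 by (simp add: vec_eq_iff field_simps)
  then show ?thesis by blast
qed

text \<open>Gram-Schmidt without division: removing from the third basis vector its component along
  the positive vector \<open>c\<close> can only decrease the form.\<close>

lemma exists_negative_orthogonal:
  assumes "Re (herm c c) > 0"
  obtains z where "Re (herm z z) < 0" "herm z c = 0"
proof -
  define e :: "complex^3" where "e = axis 3 1"
  define n where "n = Re (herm c c)"
  have n: "n > 0" "herm c c = of_real n" using assms herm_self[of c] by (auto simp: n_def)
  have e: "herm e e = -1" by (simp add: e_def herm_def axis_def)
  define z where "z = of_real n *s e - herm e c *s c"
  have zc: "herm z c = 0" by (simp add: z_def herm_linear n)
  have "herm z z = of_real n * (- of_real n - herm e c * cnj (herm e c))"
    by (simp add: z_def herm_linear n e cnj_herm algebra_simps)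
  also have "\<dots> = of_real (n * (- n - (cmod (herm e c))\<^sup>2))"
    by (simp add: mult_cnj_cmod)
  finally have "Re (herm z z) = n * (- n - (cmod (herm e c))\<^sup>2)"
    by (simp only: Re_complex_of_real)
  moreover have "- n - (cmod (herm e c))\<^sup>2 < 0" using n(1) zero_le_power2[of "cmod (herm e c)"] by linarith
  ultimately have "Re (herm z z) < 0" using n(1) by (simp add: mult_pos_neg)
  then show ?thesis using zc that by blast
qed

lemma exists_negative_orthogonal_pair:
  assumes "Re (herm c c) > 0" "Re (herm d d) > 0" "herm d c = 0"
  obtains z where "Re (herm z z) < 0" "herm z c = 0" "herm z d = 0"
proof -
  obtain y where y: "Re (herm y y) < 0" "herm y c = 0"
    using exists_negative_orthogonal[OF assms(1)] .
  define n where "n = Re (herm d d)"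
  have n: "n > 0" "herm d d = of_real n" using assms herm_self[of d] by (auto simp: n_def)
  define z where "z = of_real n *s y - herm y d *s d"
  have zd: "herm z d = 0" by (simp add: z_def herm_linear n)
  have zc: "herm z c = 0" by (simp add: z_def herm_linear y assms)
  have "herm z z = of_real n * (of_real n * herm y y - herm y d * cnj (herm y d))"
    by (simp add: z_def herm_linear n cnj_herm algebra_simps)
  also have "\<dots> = of_real (n * (n * Re (herm y y) - (cmod (herm y d))\<^sup>2))"
    using herm_self[of y] by (simp add: mult_cnj_cmod)
  finally have *: "Re (herm z z) = n * (n * Re (herm y y) - (cmod (herm y d))\<^sup>2)"
    by (simp only: Re_complex_of_real)
  have "n * Re (herm y y) < 0" using n(1) y(1) by (simp add: mult_pos_neg)
  then have "n * Re (herm y y) - (cmod (herm y d))\<^sup>2 < 0"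
    using zero_le_power2[of "cmod (herm y d)"] by linarith
  then have "Re (herm z z) < 0" using * n(1) by (simp add: mult_pos_neg)
  then show ?thesis using zc zd that by blast
qed

section \<open>Points as complex lines, and uniqueness of polar vectors\<close>

lemma span_singleton_mem_iff: "w \<in> vec.span {z} \<longleftrightarrow> (\<exists>k. w = k *s (z :: complex^3))"
  by (auto simp: vec.span_singleton)

lemma orthogonal_line_iff: "(\<forall>w\<in>vec.span {z}. herm w c = 0) \<longleftrightarrow> herm z c = 0"
proof
  assume "\<forall>w\<in>vec.span {z}. herm w c = 0"
  then show "herm z c = 0" by (simp add: vec.span_base)
qed (auto simp: span_singleton_mem_iff herm_linear)

lemma span_mem_hyperbolic_plane:
  "Re (herm z z) < 0 \<Longrightarrow> vec.span {z} \<in> complex_hyperbolic_plane"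
  by (auto simp: complex_hyperbolic_plane_def)

lemma span_mem_geodesic_iff:
  assumes "polar_vector C c" "Re (herm z z) < 0"
  shows "vec.span {z} \<in> C \<longleftrightarrow> herm z c = 0"
  using assms span_mem_hyperbolic_plane[of z] orthogonal_line_iff[of z c]
  by (auto simp: polar_vector_def)

text \<open>A geodesic records only the negative lines orthogonal to \<open>c\<close>. If
  \<open>c'\<close> had a component \<open>d\<close> orthogonal to \<open>c\<close>, a negative
  vector of the geodesic could be moved slightly along \<open>d\<close>; it would stay orthogonal to
  \<open>c\<close>, hence to \<open>c'\<close>, which forces the positive vector \<open>d\<close> to
  be null.\<close>

lemma polar_vector_unique:
  assumes c: "polar_vector C c" and c': "polar_vector C c'"
  shows "\<exists>k. c' = k *s c"
proof -
  have cc: "Re (herm c c) > 0" using c by (simp add: polar_vector_def)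
  then have cc0: "herm c c \<noteq> 0" by auto
  have iff: "herm z c = 0 \<longleftrightarrow> herm z c' = 0" if "Re (herm z z) < 0" for z
    using span_mem_geodesic_iff[OF c that] span_mem_geodesic_iff[OF c' that] by blast
  define d where "d = herm c c *s c' - herm c' c *s c"
  have dc: "herm d c = 0" by (simp add: d_def herm_linear)
  have "d = 0"
  proof (rule ccontr)
    assume "d \<noteq> 0"
    obtain z where z: "Re (herm z z) < 0" "herm z c = 0"
      using exists_negative_orthogonal[OF cc] .
    have zc': "herm z c' = 0" using iff z by blast
    have dz: "herm d z = 0" using z zc' by (simp add: d_def herm_linear herm_eq_0_commute)
    have dd: "Re (herm d d) > 0"
      by (rule herm_pos_of_orthogonal_negative[OF z(1) dz \<open>d \<noteq> 0\<close>])
    \<comment> \<open>The size is chosen so that the perturbed vector \<open>y\<close> keeps half of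
      the negative value of \<open>z\<close>.\<close>
    define n where "n = sqrt (- Re (herm z z) / (2 * Re (herm d d)))"
    have n0: "n > 0" using z dd by (simp add: n_def divide_neg_pos)
    have n2: "n\<^sup>2 = - Re (herm z z) / (2 * Re (herm d d))"
      using z dd by (simp add: n_def divide_nonpos_pos)
    define y where "y = 1 *s z - of_real n *s d"
    have "Re (herm y y) = Re (herm z z) + n\<^sup>2 * Re (herm d d)"
      unfolding y_def Re_herm_combination[OF dz] by simp
    also have "\<dots> < 0" using z dd by (simp add: n2 field_simps)
    finally have "Re (herm y y) < 0" .
    moreover have "herm y c = 0" by (simp add: y_def herm_linear z dc)
    ultimately have "herm y c' = 0" using iff by blast
    then have "herm d c' = 0" using n0 zc' by (simp add: y_def herm_linear)
    then have "herm d d = 0" using dc by (simp add: d_def[THEN arg_cong[where f = "herm d"]] herm_linear)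
    then show False using dd by simp
  qed
  then have "herm c c *s c' = herm c' c *s c" by (simp add: d_def)
  then have "c' = (herm c' c / herm c c) *s c"
    using cc0 by (simp add: vec_eq_iff field_simps)
  then show ?thesis by blast
qed

section \<open>Products of complex reflections\<close>

lemma complex_reflection_linear:
  "complex_reflection c (k *s z) = k *s complex_reflection c z"
  by (simp add: complex_reflection_def herm_linear vec_eq_iff algebra_simps)

lemma complex_reflection_combination:
  "complex_reflection c (- x + k *s y) = - complex_reflection c x + k *s complex_reflection c y"
  by (simp add: complex_reflection_def herm_linear vec_eq_iff algebra_simps)

lemma herm_complex_reflection:
  assumes "herm c c = 1"
  shows "herm (complex_reflection c z) (complex_reflection c w) = herm z w"
  using assms by (simp add: complex_reflection_def herm_linear cnj_herm algebra_simps)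

lemma complex_reflection_involution:
  assumes "herm c c = 1"
  shows "complex_reflection c (complex_reflection c z) = z"
  using assms by (simp add: complex_reflection_def herm_linear vec_eq_iff algebra_simps)

lemma complex_reflection_conjugate:
  assumes "herm c c = 1"
  shows "complex_reflection c (complex_reflection d (complex_reflection c z)) =
    complex_reflection (complex_reflection c d) z"
proof -
  have "herm (complex_reflection c z) d = herm z (complex_reflection c d)"
    using herm_complex_reflection[OF assms, of "complex_reflection c z" d]
    by (simp add: complex_reflection_involution[OF assms])
  then have "complex_reflection d (complex_reflection c z) =
      - complex_reflection c z + (2 * herm z (complex_reflection c d)) *s d"
    by (simp add: complex_reflection_def)
  then have "complex_reflection c (complex_reflection d (complex_reflection c z)) =
      - complex_reflection c (complex_reflection c z)
      + (2 * herm z (complex_reflection c d)) *s complex_reflection c d"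
    by (simp only: complex_reflection_combination)
  then show ?thesis
    by (simp add: complex_reflection_involution[OF assms]
        complex_reflection_def[of "complex_reflection c d"])
qed

section \<open>Fixed points as negative eigenvectors\<close>

lemma elliptic_imp_eigenvector:
  assumes "elliptic f"
  obtains z l where "Re (herm z z) < 0" "f z = l *s z"
proof -
  obtain z where z: "Re (herm z z) < 0" "f ` vec.span {z} = vec.span {z}"
    using assms by (auto simp: elliptic_def complex_hyperbolic_plane_def)
  have "f z \<in> vec.span {z}" using z(2) vec.span_base[of z "{z}"] by blast
  then show ?thesis using z(1) that by (auto simp: span_singleton_mem_iff)
qed

lemma eigenvector_imp_elliptic:
  assumes lin: "\<And>k z. f (k *s z) = k *s f z"
    and z: "Re (herm z z) < 0" "f z = l *s z" "l \<noteq> 0"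
  shows "elliptic f"
proof -
  have "f ` vec.span {z} = vec.span {z}"
  proof
    show "f ` vec.span {z} \<subseteq> vec.span {z}"
      by (auto simp: span_singleton_mem_iff lin z(2))
    show "vec.span {z} \<subseteq> f ` vec.span {z}"
    proof
      fix w assume "w \<in> vec.span {z}"
      then obtain k where "w = k *s z" by (auto simp: span_singleton_mem_iff)
      then have "w = f ((k / l) *s z)" using z(3) by (simp add: lin z(2))
      then show "w \<in> f ` vec.span {z}"
        by (rule image_eqI) (auto simp: span_singleton_mem_iff)
    qed
  qed
  then show ?thesis
    unfolding elliptic_def using span_mem_hyperbolic_plane[OF z(1)] by blast
qed

text \<open>Used in two ways: the eigenvalue of a negative vector is unimodular, and eigenvectors
  for distinct unimodular eigenvalues are orthogonal.\<close>

lemma isometry_eigenvalues: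
  assumes iso: "herm (f y) (f z) = herm y z" and "f y = k *s y" "f z = l *s z"
    and "herm y z \<noteq> 0"
  shows "k * cnj l = 1"
proof -
  have "k * cnj l * herm y z = herm y z" using assms by (simp add: herm_linear algebra_simps)
  then show ?thesis using assms(4) by simp
qed

text \<open>Let \<open>l\<close> be the eigenvalue of a negative fixed vector \<open>z\<close>. If
  \<open>l = 1\<close>, then \<open>z\<close> is orthogonal to \<open>a\<close> and
  \<open>b\<close>, so the form is positive definite on their span. Otherwise \<open>z\<close> lies
  in that span, and pairing with \<open>a\<close> and \<open>b\<close> gives
  \<open>(l + 1)^2 = 4 * l * |h|^2\<close> when \<open>h\<close> is nonzero. Since
  \<open>|l + 1| \<le> 2\<close>, \<open>|h| \<ge> 1\<close> would force \<open>|h| = 1\<close> and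
  then \<open>l = 1\<close>.\<close>

lemma elliptic_two_reflections:
  assumes a: "herm a a = 1" and b: "herm b b = 1" and ne: "\<And>k. a \<noteq> k *s b"
    and ell: "elliptic (complex_reflection b \<circ> complex_reflection a)"
  shows "cmod (herm a b) < 1"
proof -
  obtain z l where z: "Re (herm z z) < 0"
      and zl: "(complex_reflection b \<circ> complex_reflection a) z = l *s z"
    using elliptic_imp_eigenvector[OF ell] .
  define h u w where "h = herm a b" and "u = herm z a" and "w = herm z b"
  have ba: "herm b a = cnj h" by (simp add: h_def cnj_herm)
  have z0: "z \<noteq> 0" using z by (auto simp: herm_def)
  have "herm z z \<noteq> 0" using z by auto
  moreover have "herm ((complex_reflection b \<circ> complex_reflection a) z)
      ((complex_reflection b \<circ> complex_reflection a) z) = herm z z"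
    by (simp add: herm_complex_reflection a b)
  ultimately have "l * cnj l = 1"
    using isometry_eigenvalues[where f = "complex_reflection b \<circ> complex_reflection a", OF _ zl zl] by blast
  then have l1: "cmod l = 1" by (rule cmod_eq_1_of_mult_cnj)
  \<comment> \<open>The reflection in \<open>b\<close> is an involution, so the eigenvalue equation
    compares two single reflections of \<open>z\<close>.\<close>
  have "complex_reflection a z = complex_reflection b (l *s z)"
    using zl complex_reflection_involution[OF b] by (metis comp_apply)
  then have "complex_reflection a z = l *s complex_reflection b z"
    by (simp add: complex_reflection_linear)
  then have eq: "(l - 1) *s z = (2 * l * w) *s b - (2 * u) *s a"
    unfolding complex_reflection_def u_def w_def
    by (simp add: vec_eq_iff algebra_simps)
  show ?thesis
  proof (cases "l = 1")
    case True
    then have wu: "w *s b = u *s a" using eq by (simp add: vec_eq_iff)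
    have u: "u = 0"
    proof (rule ccontr)
      assume "u \<noteq> 0"
      then have "a = (w / u) *s b" using wu by (simp add: vec_eq_iff field_simps)
      then show False using ne by blast
    qed
    have "b \<noteq> 0" using b by (auto simp: herm_def)
    then have w: "w = 0" using wu u by simp
    define d where "d = a - h *s b"
    have "d \<noteq> 0" using ne[of h] by (simp add: d_def)
    moreover have "herm z d = 0" using u w by (simp add: d_def herm_linear u_def w_def)
    ultimately have "Re (herm d d) > 0"
      using herm_pos_of_orthogonal_negative[OF z] herm_eq_0_commute by blast
    moreover have "herm d d = 1 - h * cnj h"
      by (simp add: d_def herm_linear a b ba h_def[symmetric] algebra_simps)
    ultimately have "(cmod h)\<^sup>2 < 1" by (simp add: mult_cnj_cmod flip: of_real_power)
    then show ?thesis by (simp add: h_def power_less_one_iff abs_square_less_1)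
  next
    case False
    have e1: "(l + 1) * u = 2 * l * w * cnj h"
    proof -
      have "herm ((l - 1) *s z) a = 2 * l * w * cnj h - 2 * u"
        unfolding eq by (simp add: herm_linear a ba)
      then show ?thesis by (simp add: herm_linear u_def algebra_simps)
    qed
    have e2: "(l + 1) * w = 2 * u * h"
    proof -
      have "herm ((l - 1) *s z) b = 2 * l * w - 2 * u * h"
        unfolding eq by (simp add: herm_linear b h_def)
      then show ?thesis by (simp add: herm_linear w_def algebra_simps)
    qed
    show ?thesis
    proof (rule ccontr)
      assume "\<not> cmod (herm a b) < 1"
      then have h1: "cmod h \<ge> 1" by (simp add: h_def)
      then have h0: "h \<noteq> 0" by auto
      have l0: "l \<noteq> 0" using l1 by auto
      have nz: "\<not> (u = 0 \<and> w = 0)"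
      proof
        assume "u = 0 \<and> w = 0"
        then have "(l - 1) *s z = 0" unfolding eq by simp
        then show False using False z0 by (simp only: vec.scale_eq_0_iff right_minus_eq simp_thms)
      qed
      have u0: "u \<noteq> 0" using e1 nz h0 l0 by auto
      have w0: "w \<noteq> 0" using e2 nz h0 by auto
      \<comment> \<open>Multiplying the two equations lets the nonzero factor \<open>u * w\<close>
        cancel.\<close>
      have "(l + 1) * u * ((l + 1) * w) = 2 * l * w * cnj h * (2 * u * h)"
        unfolding e1 e2 ..
      then have "(u * w) * (l + 1)\<^sup>2 = (u * w) * (4 * l * (h * cnj h))"
        by (simp add: power2_eq_square algebra_simps)
      then have sq: "(l + 1)\<^sup>2 = 4 * l * (h * cnj h)" using u0 w0 by simp
      have "(cmod (l + 1))\<^sup>2 = 4 * (cmod h)\<^sup>2"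
        using arg_cong[OF sq, of cmod] l1 by (simp add: norm_mult norm_power power2_eq_square)
      moreover have "cmod (l + 1) \<le> 2" using norm_triangle_ineq[of l 1] l1 by simp
      then have "(cmod (l + 1))\<^sup>2 \<le> 2\<^sup>2" by (intro power_mono) auto
      ultimately have "cmod h \<le> 1" by (simp add: abs_square_le_1)
      then have "cmod h = 1" using h1 by simp
      then have "(l + 1)\<^sup>2 = 4 * l" using sq by (simp add: mult_cnj_cmod)
      then have "(l - 1)\<^sup>2 = 0" by (simp add: power2_eq_square algebra_simps)
      then show False using False by simp
    qed
  qed
qed

text \<open>The equality says that the Gram determinant of \<open>c1\<close>, \<open>c2\<close>,
  \<open>c3\<close> vanishes. Pairing the linear relation with the three vectors and eliminating
  \<open>p\<close> and \<open>q\<close> gives it.\<close>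

lemma gram_det_dependent:
  assumes c1: "herm c1 c1 = 1" and c2: "herm c2 c2 = 1" and c3: "herm c3 c3 = 1"
    and eq: "c1 = p *s c2 + q *s c3"
  shows "1 + 2 * Re (herm c3 c2 * herm c1 c3 * herm c2 c1) =
    (cmod (herm c3 c2))\<^sup>2 + (cmod (herm c1 c3))\<^sup>2 + (cmod (herm c2 c1))\<^sup>2"
proof -
  have e1: "1 = p * herm c2 c1 + q * herm c3 c1"
    using arg_cong[OF eq, of "\<lambda>x. herm x c1"] c1 by (simp add: herm_linear)
  have e2: "herm c1 c2 = p + q * herm c3 c2"
    using arg_cong[OF eq, of "\<lambda>x. herm x c2"] c2 by (simp add: herm_linear)
  have e3: "herm c1 c3 = p * herm c2 c3 + q"
    using arg_cong[OF eq, of "\<lambda>x. herm x c3"] c3 by (simp add: herm_linear)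
  have "1 + herm c3 c2 * herm c1 c3 * herm c2 c1 + herm c2 c3 * herm c3 c1 * herm c1 c2 =
     herm c3 c2 * herm c2 c3 + herm c1 c3 * herm c3 c1 + herm c2 c1 * herm c1 c2"
    using e1 e2 e3 by algebra
  then have "1 + (herm c3 c2 * herm c1 c3 * herm c2 c1 +
       cnj (herm c3 c2 * herm c1 c3 * herm c2 c1)) =
     herm c3 c2 * cnj (herm c3 c2) + herm c1 c3 * cnj (herm c1 c3) + herm c2 c1 * cnj (herm c2 c1)"
    by (simp only: complex_cnj_mult cnj_herm add.assoc)
  then have "complex_of_real (1 + 2 * Re (herm c3 c2 * herm c1 c3 * herm c2 c1)) =
    of_real ((cmod (herm c3 c2))\<^sup>2 + (cmod (herm c1 c3))\<^sup>2 + (cmod (herm c2 c1))\<^sup>2)"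
    by (simp only: complex_add_cnj mult_cnj_cmod of_real_add of_real_1 of_real_power)
  then show ?thesis unfolding of_real_eq_iff .
qed

text \<open>With \<open>b\<close> the image of \<open>c2\<close> under the third reflection, the
  word is the product of the reflections in \<open>b\<close> and \<open>c1\<close>, and the
  left-hand side is \<open>|herm c1 b|^2\<close>. The Gram hypothesis keeps \<open>c1\<close> and
  \<open>b\<close> from being proportional.\<close>

lemma elliptic_word_A:
  assumes c1: "herm c1 c1 = 1" and c2: "herm c2 c2 = 1" and c3: "herm c3 c3 = 1"
    and ell: "elliptic (word_A c1 c2 c3)"
    and gram: "1 + 2 * Re (herm c3 c2 * herm c1 c3 * herm c2 c1) \<noteq>
      (cmod (herm c3 c2))\<^sup>2 + (cmod (herm c1 c3))\<^sup>2 + (cmod (herm c2 c1))\<^sup>2"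
  shows "(cmod (herm c2 c1))\<^sup>2 + 4 * (cmod (herm c3 c2))\<^sup>2 * (cmod (herm c1 c3))\<^sup>2
    - 4 * Re (herm c3 c2 * herm c1 c3 * herm c2 c1) < 1"
proof -
  define b where "b = complex_reflection c3 c2"
  have "word_A c1 c2 c3 = complex_reflection b \<circ> complex_reflection c1"
    by (auto simp: word_A_def b_def complex_reflection_conjugate[OF c3])
  moreover have "herm b b = 1" by (simp add: b_def herm_complex_reflection c2 c3)
  moreover have "c1 \<noteq> k *s b" for k
  proof
    assume "c1 = k *s b"
    then have "c1 = (- k) *s c2 + (2 * k * herm c2 c3) *s c3"
      by (simp add: b_def complex_reflection_def vec_eq_iff algebra_simps)
    from gram_det_dependent[OF c1 c2 c3 this] gram show False by simp
  qed
  ultimately have "cmod (herm c1 b) < 1"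
    using elliptic_two_reflections[OF c1] ell by metis
  then have "(cmod (herm c1 b))\<^sup>2 < 1" by (simp add: abs_square_less_1)
  moreover have "(cmod (herm c1 b))\<^sup>2 = (cmod (herm c2 c1))\<^sup>2
     + 4 * (cmod (herm c3 c2))\<^sup>2 * (cmod (herm c1 c3))\<^sup>2
     - 4 * Re (herm c3 c2 * herm c1 c3 * herm c2 c1)"
  proof -
    define x y w where "x = herm c3 c2" and "y = herm c1 c3" and "w = herm c2 c1"
    have c1b: "herm c1 b = 2 * x * y - cnj w"
      by (simp add: b_def complex_reflection_def herm_linear x_def y_def w_def cnj_herm)
    then have "herm c1 b * cnj (herm c1 b) =
        4 * (x * cnj x) * (y * cnj y) + w * cnj w - 2 * (x * y * w + cnj (x * y * w))"
      unfolding c1b by (simp add: algebra_simps)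
    also have "x * y * w + cnj (x * y * w) = of_real (2 * Re (x * y * w))"
      by (rule complex_add_cnj)
    finally have "complex_of_real ((cmod (herm c1 b))\<^sup>2) =
        of_real (4 * (cmod x)\<^sup>2 * (cmod y)\<^sup>2 + (cmod w)\<^sup>2 - 4 * Re (x * y * w))"
      by (simp add: mult_cnj_cmod)
    then show ?thesis unfolding of_real_eq_iff x_def y_def w_def by simp
  qed
  ultimately show ?thesis by simp
qed

section \<open>Angles of complex geodesics\<close>

lemma exists_kernel_vector:
  fixes A :: "complex^3^3"
  assumes "det A = 0"
  obtains x where "x \<noteq> 0" "A *v x = 0"
  using assms invertible_det_nz[of A] matrix_left_invertible_ker[of A] invertible_left_inverse
  by metis

text \<open>A null vector orthogonal to \<^term>\<open>c\<close> and \<^term>\<open>d\<close> has vanishing Gram determinant with them,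
  so it is a linear combination of them.\<close>

lemma cmod_herm_eq_1_of_null:
  assumes c: "herm c c = 1" and d: "herm d d = 1"
    and z: "z \<noteq> 0" "herm z z = 0" "herm z c = 0" "herm z d = 0"
  shows "cmod (herm c d) = 1"
proof -
  define h where "h = herm c d"
  have dc: "herm d c = cnj h" by (simp add: h_def cnj_herm)
  have hcd: "herm c d = h" by (simp add: h_def)
  define A :: "complex^3^3" where "A = vector [z, c, d]"
  have "det A = 0"
  proof (rule ccontr)
    assume "det A \<noteq> 0"
    \<comment> \<open>Conjugating \<open>z\<close> and inserting the sign of the form turns matrix
      multiplication into pairing with \<open>z\<close>.\<close>
    define w :: "complex^3" where "w = vector [cnj (z$1), cnj (z$2), - cnj (z$3)]"
    have "A *v w = vector [herm z z, herm c z, herm d z]"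
      by (simp add: A_def w_def matrix_vector_mult_def vec_eq_iff forall_3 sum_3 herm_def)
    also have "\<dots> = 0" using z by (simp add: vec_eq_iff forall_3 herm_eq_0_commute)
    finally have "w = 0"
      using \<open>det A \<noteq> 0\<close> invertible_det_nz[of A] matrix_left_invertible_ker[of A]
        invertible_left_inverse by metis
    then have "z = 0" by (simp add: w_def vec_eq_iff forall_3)
    then show False using z by simp
  qed
  then have "det (transpose A) = 0" by (simp add: det_transpose)
  then obtain x where x: "x \<noteq> 0" "transpose A *v x = 0" by (rule exists_kernel_vector)
  have "x$1 *s z + x$2 *s c + x$3 *s d = transpose A *v x"
    by (simp add: A_def matrix_vector_mult_def transpose_def vec_eq_iff sum_3)
  then have sum: "x$1 *s z + x$2 *s c + x$3 *s d = 0" using x by simp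
  have e1: "x$2 + x$3 * cnj h = 0"
    using arg_cong[OF sum, of "\<lambda>y. herm y c"] by (simp add: herm_linear z c dc)
  have e2: "x$2 * h + x$3 = 0"
    using arg_cong[OF sum, of "\<lambda>y. herm y d"] by (simp add: herm_linear z d hcd)
  have "x$3 \<noteq> 0"
  proof
    assume "x$3 = 0"
    moreover from this have "x$2 = 0" using e1 by simp
    ultimately have "x$1 *s z = 0" using sum by simp
    then have "x$1 = 0" using z by (simp add: vec.scale_eq_0_iff)
    then show False using \<open>x$3 = 0\<close> \<open>x$2 = 0\<close> x(1) by (simp add: vec_eq_iff forall_3)
  qed
  \<comment> \<open>Pairing the relation with \<open>c\<close> and \<open>d\<close> removed
    \<open>z\<close>; what remains says that the Gram matrix of \<open>c\<close> and
    \<open>d\<close> is singular.\<close>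
  moreover have "x$3 * (h * cnj h - 1) = 0" using e1 e2 by algebra
  ultimately have "h * cnj h = 1" by simp
  then show ?thesis unfolding h_def by (rule cmod_eq_1_of_mult_cnj)
qed

lemma cmod_proportional_unit:
  assumes "herm c c = 1" "herm (k *s c) (k *s c) = 1"
  shows "cmod k = 1"
proof -
  have "k * cnj k = 1" using assms by (simp add: herm_linear mult.commute)
  then show ?thesis by (rule cmod_eq_1_of_mult_cnj)
qed

text \<open>\<open>meet_at_angle\<close> asserts the cosine only for some normalised polar vectors;
  this transfers it to any given ones, since these differ by unit scalars.\<close>

lemma cmod_herm_normalised_polar_vectors:
  assumes "normalised_polar_vector C c" "normalised_polar_vector C b"
    "normalised_polar_vector C' c'" "normalised_polar_vector C' b'"
  shows "cmod (herm c c') = cmod (herm b b')"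
proof -
  have u: "herm c c = 1" "herm b b = 1" "herm c' c' = 1" "herm b' b' = 1"
    using assms by (auto simp: normalised_polar_vector_def)
  obtain k where k: "b = k *s c"
    using polar_vector_unique assms(1,2) unfolding normalised_polar_vector_def by blast
  obtain l where l: "b' = l *s c'"
    using polar_vector_unique assms(3,4) unfolding normalised_polar_vector_def by blast
  have "cmod k = 1" "cmod l = 1" using cmod_proportional_unit u k l by blast+
  then show ?thesis by (simp add: k l herm_linear norm_mult)
qed

lemma ideal_points_iff:
  assumes "polar_vector C c"
  shows "L \<in> ideal_points C \<longleftrightarrow> (\<exists>z. L = vec.span {z} \<and> z \<noteq> 0 \<and> herm z z = 0 \<and> herm z c = 0)"
proof
  assume "L \<in> ideal_points C"
  then obtain z b where z: "L = vec.span {z}" "z \<noteq> 0" "herm z z = 0"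
      and b: "polar_vector C b" "\<forall>w\<in>L. herm w b = 0"
    by (auto simp: ideal_points_def ideal_boundary_def)
  obtain k where k: "c = k *s b" using polar_vector_unique[OF b(1) assms] by blast
  have "herm z b = 0" using b(2) orthogonal_line_iff by (simp add: z(1))
  then show "\<exists>z. L = vec.span {z} \<and> z \<noteq> 0 \<and> herm z z = 0 \<and> herm z c = 0"
    using z by (auto simp: k herm_linear)
next
  assume "\<exists>z. L = vec.span {z} \<and> z \<noteq> 0 \<and> herm z z = 0 \<and> herm z c = 0"
  then show "L \<in> ideal_points C"
    using assms orthogonal_line_iff by (auto simp: ideal_points_def ideal_boundary_def)
qed

lemma meet_at_angle_imp_cmod_herm:
  assumes meet: "meet_at_angle C C' \<phi>"
    and c: "normalised_polar_vector C c" and c': "normalised_polar_vector C' c'"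
  shows "cmod (herm c c') = cos \<phi>"
proof (cases "\<phi> = 0")
  case True
  have p: "polar_vector C c" "polar_vector C' c'" "herm c c = 1" "herm c' c' = 1"
    using c c' by (auto simp: normalised_polar_vector_def)
  obtain L where L: "L \<in> ideal_points C" "L \<in> ideal_points C'"
    using meet True by (auto simp: meet_at_angle_def)
  obtain z where z: "L = vec.span {z}" "z \<noteq> 0" "herm z z = 0" "herm z c = 0"
    using L(1) ideal_points_iff[OF p(1)] by blast
  obtain y where y: "L = vec.span {y}" "herm y c' = 0"
    using L(2) ideal_points_iff[OF p(2)] by blast
  have "herm z c' = 0" using y z orthogonal_line_iff[of y c'] orthogonal_line_iff[of z c'] by simp
  then show ?thesis using cmod_herm_eq_1_of_null[OF p(3,4) z(2,3,4)] True by simp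
next
  case False
  then obtain b b' where "normalised_polar_vector C b" "normalised_polar_vector C' b'"
      "cmod (herm b b') = cos \<phi>"
    using meet by (auto simp: meet_at_angle_def)
  then show ?thesis using cmod_herm_normalised_polar_vectors c c' by metis
qed

text \<open>Let \<open>d\<close> be the component of \<open>c\<close> orthogonal to
  \<open>c'\<close>, so that \<open>herm d d = 1 - |h|^2\<close>. At angle 0 it is null and spans
  the only common ideal point. Otherwise it is positive, and a negative vector orthogonal to
  \<open>c'\<close> and \<open>d\<close> represents a common point.\<close>

lemma meet_at_angleI:
  assumes c: "normalised_polar_vector C c" and c': "normalised_polar_vector C' c'"
    and phi: "cmod (herm c c') = cos \<phi>" "0 \<le> \<phi>" "\<phi> \<le> pi / 2" and ne: "\<And>k. c \<noteq> k *s c'"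
  shows "meet_at_angle C C' \<phi>"
proof -
  have p: "polar_vector C c" "polar_vector C' c'" "herm c c = 1" "herm c' c' = 1"
    using c c' by (auto simp: normalised_polar_vector_def)
  define h where "h = herm c c'"
  have hs: "herm c c' = h" "herm c' c = cnj h" by (simp_all add: h_def cnj_herm)
  define d where "d = c - h *s c'"
  have d0: "d \<noteq> 0" using ne[of h] by (simp add: d_def)
  have dc': "herm d c' = 0" by (simp add: d_def herm_linear p hs)
  have "herm d d = 1 - h * cnj h"
    by (simp add: d_def herm_linear p hs)
  then have dd: "herm d d = of_real (1 - (cmod h)\<^sup>2)" by (simp add: mult_cnj_cmod)
  have dc: "herm d c = of_real (1 - (cmod h)\<^sup>2)"
    by (simp add: d_def herm_linear p hs mult_cnj_cmod)
  have "C \<noteq> C'" using polar_vector_unique[OF p(2)] p(1) ne by blast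
  moreover have "\<exists>!L. L \<in> ideal_points C \<inter> ideal_points C'" if "\<phi> = 0"
  proof -
    have "cmod h = 1" using phi that by (simp add: h_def)
    then have d: "herm d d = 0" "herm d c = 0" by (simp_all add: dd dc)
    show ?thesis
    proof (rule ex1I[of _ "vec.span {d}"])
      show "vec.span {d} \<in> ideal_points C \<inter> ideal_points C'"
        using d d0 dc' by (auto simp: ideal_points_iff[OF p(1)] ideal_points_iff[OF p(2)])
    next
      fix L assume "L \<in> ideal_points C \<inter> ideal_points C'"
      then have L: "L \<in> ideal_points C" "L \<in> ideal_points C'" by auto
      obtain z where z: "L = vec.span {z}" "z \<noteq> 0" "herm z z = 0" "herm z c = 0"
        using L(1) ideal_points_iff[OF p(1)] by blast
      obtain y where y: "L = vec.span {y}" "herm y c' = 0"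
        using L(2) ideal_points_iff[OF p(2)] by blast
      have "herm z c' = 0"
        using y z orthogonal_line_iff[of y c'] orthogonal_line_iff[of z c'] by simp
      then have "herm z d = 0" using z by (simp add: d_def herm_linear)
      then obtain k where k: "z = k *s d"
        using orthogonal_null_proportional[OF d(1) d0 z(3)] by blast
      then have "k \<noteq> 0" using z by auto
      have "k' *s d \<in> range (\<lambda>k'. k' *s z)" for k'
        by (rule range_eqI[of _ _ "k' / k"]) (use \<open>k \<noteq> 0\<close> in \<open>simp add: k\<close>)
      then show "L = vec.span {d}"
        unfolding z(1) vec.span_singleton by (auto simp: k)
    qed
  qed
  moreover have "C \<inter> C' \<noteq> {}" if "\<phi> \<noteq> 0"
  proof -
    have "cos \<phi> < cos 0"
      by (rule cos_monotone_0_pi) (use that phi pi_gt_zero in linarith)+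
    then have "(cmod h)\<^sup>2 < 1" using phi norm_ge_zero[of "herm c c'"]
      by (simp add: h_def abs_square_less_1)
    then have "Re (herm d d) > 0" unfolding dd by simp
    moreover have "Re (herm c' c') > 0" using p by simp
    ultimately obtain z where z: "Re (herm z z) < 0" "herm z c' = 0" "herm z d = 0"
      using exists_negative_orthogonal_pair[OF _ _ dc'] by blast
    have "herm z c = 0" using z by (simp add: d_def herm_linear)
    then show ?thesis
      using z span_mem_geodesic_iff[OF p(1) z(1)] span_mem_geodesic_iff[OF p(2) z(1)] by blast
  qed
  ultimately show ?thesis
    unfolding meet_at_angle_def complex_geodesic_def using p c c' phi by force
qed

section \<open>Goldman's discriminant\<close>

lemma self_dual_cubic_roots:
  fixes \<tau> :: complex
  obtains a b c where "a + b + c = \<tau>" "a * b + a * c + b * c = cnj \<tau>" "a * b * c = 1"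
proof -
  have "\<not> constant (poly [:- 1, cnj \<tau>, - \<tau>, 1:])"
    by (simp add: constant_degree)
  then obtain a where "poly [:- 1, cnj \<tau>, - \<tau>, 1:] a = 0"
    using fundamental_theorem_of_algebra by blast
  then have a: "a * (a * (a - \<tau>) + cnj \<tau>) = 1" by (simp add: algebra_simps)
  \<comment> \<open>The other two zeros are those of the quotient \<open>X^2 - p X + q\<close> of
    the cubic by \<open>X - a\<close>.\<close>
  define p q where "p = \<tau> - a" and "q = a * (a - \<tau>) + cnj \<tau>"
  define s where "s = csqrt (p\<^sup>2 - 4 * q)"
  have s2: "s\<^sup>2 = p\<^sup>2 - 4 * q" by (simp add: s_def)
  define b c where "b = (p + s) / 2" and "c = (p - s) / 2"
  have bc: "b + c = p" by (simp add: b_def c_def field_simps)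
  have "4 * (b * c) = p\<^sup>2 - s\<^sup>2" by (simp add: b_def c_def power2_eq_square field_simps)
  then have "4 * (b * c) = 4 * q" using s2 by simp
  then have bc': "b * c = q" by simp
  have "a + b + c = \<tau>" using bc by (simp add: p_def add.assoc)
  moreover have "a * b + a * c + b * c = cnj \<tau>"
  proof -
    have "a * b + a * c + b * c = a * (b + c) + b * c" by (simp add: distrib_left)
    then show ?thesis unfolding bc bc' by (simp add: p_def q_def algebra_simps)
  qed
  moreover have "a * b * c = 1" using a bc' by (simp add: q_def mult.assoc)
  ultimately show ?thesis using that by blast
qed

text \<open>The discriminant of \<open>X^3 - \<tau> X^2 + cnj \<tau> X - 1\<close>; it is real
  because this cubic is self-dual. Negative values belong to regular elliptic isometries.\<close>

definition goldman_discriminant :: "complex \<Rightarrow> real" where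
  "goldman_discriminant \<tau> = (cmod \<tau>) ^ 4 - 8 * Re (\<tau> ^ 3) + 18 * (cmod \<tau>)\<^sup>2 - 27"

lemma goldman_discriminant_roots:
  assumes e1: "a + b + c = \<tau>" and e2: "a * b + a * c + b * c = cnj \<tau>" and e3: "a * b * c = 1"
  shows "((a - b) * (a - c) * (b - c))\<^sup>2 = of_real (goldman_discriminant \<tau>)"
proof -
  have "((a - b) * (a - c) * (b - c))\<^sup>2 =
      (a + b + c)\<^sup>2 * (a * b + a * c + b * c)\<^sup>2 - 4 * (a * b + a * c + b * c) ^ 3
      - 4 * (a + b + c) ^ 3 * (a * b * c)
      + 18 * (a + b + c) * (a * b + a * c + b * c) * (a * b * c) - 27 * (a * b * c)\<^sup>2"
    by algebra
  also have "\<dots> = \<tau>\<^sup>2 * (cnj \<tau>)\<^sup>2 - 4 * (cnj \<tau>) ^ 3 - 4 * \<tau> ^ 3 + 18 * \<tau> * cnj \<tau> - 27"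
    unfolding e1 e2 e3 by simp
  also have "\<dots> = (\<tau> * cnj \<tau>)\<^sup>2 - 4 * (\<tau> ^ 3 + cnj (\<tau> ^ 3)) + 18 * (\<tau> * cnj \<tau>) - 27"
    by (simp add: power_mult_distrib algebra_simps)
  also have "\<dots> = of_real (goldman_discriminant \<tau>)"
    unfolding mult_cnj_cmod complex_add_cnj goldman_discriminant_def by simp
  finally show ?thesis .
qed

text \<open>Conjugation sends \<open>a\<close>, \<open>b\<close>, \<open>c\<close> to
  \<open>1/b\<close>, \<open>1/a\<close>, \<open>1/c\<close>. Inversion and the swap each change the
  sign of the product of differences, up to the factor \<open>(a * b * c)^2 = 1\<close>, so this
  product is real.\<close>

lemma reciprocal_pair_discriminant:
  assumes "a * cnj b = 1" and "c * cnj c = 1" and "a * b * c = 1"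
  shows "Im ((a - b) * (a - c) * (b - c)) = 0"
proof -
  have b': "b * cnj a = 1" using arg_cong[OF assms(1), of cnj] by (simp add: mult.commute)
  define x y z where "x = cnj a" and "y = cnj b" and "z = cnj c"
  have *: "a * y = 1" "b * x = 1" "c * z = 1" "a * b * c = 1"
    using assms b' by (simp_all add: x_def y_def z_def)
  have "(x - y) * (x - z) * (y - z) = (a - b) * (a - c) * (b - c)"
    using * by algebra
  then have "cnj ((a - b) * (a - c) * (b - c)) = (a - b) * (a - c) * (b - c)"
    by (simp add: x_def y_def z_def)
  then show ?thesis by (metis Reals_cnj_iff complex_is_Real_iff)
qed

text \<open>The zeros are permuted by inversion in the unit circle. A zero off the circle would be
  paired with another one, leaving the third on the circle; the product of differences would then be
  real and its square, the discriminant, nonnegative.\<close>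

lemma root_unimodular:
  assumes e1: "a + b + c = \<tau>" and e2: "a * b + a * c + b * c = cnj \<tau>" and e3: "a * b * c = 1"
    and neg: "goldman_discriminant \<tau> < 0"
  shows "cmod a = 1"
proof (rule ccontr)
  assume na: "cmod a \<noteq> 1"
  have naa: "a * cnj a \<noteq> 1" using na cmod_eq_1_of_mult_cnj by blast
  have nonreal: "Im ((a - b) * (a - c) * (b - c)) \<noteq> 0"
  proof
    assume "Im ((a - b) * (a - c) * (b - c)) = 0"
    then obtain r where "(a - b) * (a - c) * (b - c) = of_real r"
      by (metis complex_is_Real_iff Reals_cases)
    then have "complex_of_real (r\<^sup>2) = of_real (goldman_discriminant \<tau>)"
      using goldman_discriminant_roots[OF e1 e2 e3] by simp
    then show False using neg unfolding of_real_eq_iff by (metis not_less zero_le_power2)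
  qed
  define x where "x = cnj a"
  have "cnj a + cnj b + cnj c = a * b + a * c + b * c" using e2 by (simp flip: e1)
  moreover have "cnj a * cnj b + cnj a * cnj c + cnj b * cnj c = a + b + c"
    using arg_cong[OF e2, of cnj] by (simp add: e1)
  moreover have e3': "cnj a * cnj b * cnj c = 1" using arg_cong[OF e3, of cnj] by simp
  \<comment> \<open>The product is, up to sign, the conjugated cubic at its zero
    \<open>cnj a\<close>; hence one of the three zeros is \<open>1 / cnj a\<close>.\<close>
  ultimately have "(1 - a * x) * (1 - b * x) * (1 - c * x) = 0"
    using e3 unfolding x_def by algebra
  then have "a * x = 1 \<or> b * x = 1 \<or> c * x = 1" by simp
  then consider "b * cnj a = 1" | "c * cnj a = 1" using naa by (auto simp: x_def)
  then show False
  proof cases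
    case 1
    have "a * cnj b = cnj (b * cnj a)" by simp
    then have ab: "a * cnj b = 1" using 1 by simp
    have "c * cnj c = 1" using 1 ab e3 e3' by algebra
    then show False using reciprocal_pair_discriminant[OF ab _ e3] nonreal by blast
  next
    case 2
    have "a * cnj c = cnj (c * cnj a)" by simp
    then have ac: "a * cnj c = 1" using 2 by simp
    have "b * cnj b = 1" using 2 ac e3 e3' by algebra
    moreover have "a * c * b = 1" using e3 by (simp add: ac_simps)
    ultimately have "Im ((a - c) * (a - b) * (c - b)) = 0"
      using reciprocal_pair_discriminant[OF ac] by blast
    moreover have "(a - b) * (a - c) * (b - c) = - ((a - c) * (a - b) * (c - b))"
      by algebra
    ultimately show False using nonreal by simp
  qed
qed

section \<open>Eigenvectors of the word B\<close>

lemma word_B_scale: "word_B c1 c2 c3 (k *s z) = k *s word_B c1 c2 c3 z"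
  by (simp add: word_B_def complex_reflection_linear)

lemma word_B_add: "word_B c1 c2 c3 (x + y) = word_B c1 c2 c3 x + word_B c1 c2 c3 y"
proof -
  have "complex_reflection c (x + y) = complex_reflection c x + complex_reflection c y" for c x y
    by (simp add: complex_reflection_def herm_linear vec_eq_iff algebra_simps)
  then show ?thesis by (simp add: word_B_def)
qed

lemma herm_word_B:
  assumes "herm c1 c1 = 1" "herm c2 c2 = 1" "herm c3 c3 = 1"
  shows "herm (word_B c1 c2 c3 x) (word_B c1 c2 c3 y) = herm x y"
  using assms by (simp add: word_B_def herm_complex_reflection)

text \<open>For \<open>l \<noteq> -1\<close>, the eigenvalue equation expresses \<open>z\<close> through the numbers \<open>herm z c1\<close>,
  \<open>herm z c2\<close>, \<open>herm z c3\<close>, which solve a linear system of determinant \<open>- (l^3 - \<tau> l^2 + cnj \<tau> l - 1)\<close>.\<close>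

lemma word_B_eigenvector:
  assumes c1: "herm c1 c1 = 1" and c2: "herm c2 c2 = 1" and c3: "herm c3 c3 = 1"
    and t: "\<tau> = 3 - 4 * (herm c3 c2 * herm c2 c3 + herm c1 c3 * herm c3 c1 + herm c2 c1 * herm c1 c2)
          + 8 * (herm c3 c2 * herm c1 c3 * herm c2 c1)"
    and root: "l ^ 3 - \<tau> * l\<^sup>2 + cnj \<tau> * l - 1 = 0" and l: "l \<noteq> -1"
  obtains z where "z \<noteq> 0" "word_B c1 c2 c3 z = l *s z"
proof -
  define a A b B q Q where "a = herm c3 c2" and "A = herm c2 c3" and "b = herm c1 c3"
    and "B = herm c3 c1" and "q = herm c2 c1" and "Q = herm c1 c2"
  note h = a_def A_def b_def B_def q_def Q_def
  have t1: "\<tau> = 3 - 4 * (a * A + b * B + q * Q) + 8 * (a * b * q)" using t by (simp add: h)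
  have t2: "cnj \<tau> = 3 - 4 * (a * A + b * B + q * Q) + 8 * (A * B * Q)"
    unfolding t by (simp add: cnj_herm h algebra_simps)
  \<comment> \<open>The rows are the equation \<open>(1 + l) *s z = y\<close>, with \<open>y\<close>
    as below, paired with \<open>c1\<close>, \<open>c2\<close> and \<open>c3\<close>; the unknowns
    are \<open>herm z c1\<close>, \<open>herm z c2\<close>, \<open>herm z c3\<close>.\<close>
  define M :: "complex^3^3" where "M = vector [
     vector [1 - l, - 2 * q, 4 * a * q - 2 * B],
     vector [- 2 * l * Q, l - 1, 2 * a],
     vector [- 2 * l * b, - 2 * A, l - 1 + 4 * a * A]]"
  have "det M = - (l ^ 3 - \<tau> * l\<^sup>2 + cnj \<tau> * l - 1)"
    unfolding t2 unfolding t1 by (simp add: M_def det_3 power2_eq_square power3_eq_cube algebra_simps)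
  then have "det M = 0" using root by simp
  then obtain x where x: "x \<noteq> 0" "M *v x = 0" by (rule exists_kernel_vector)
  have "(M *v x)$1 = 0" "(M *v x)$2 = 0" "(M *v x)$3 = 0" using x by simp_all
  then have eq1: "(1 - l) * x$1 - 2 * q * x$2 + (4 * a * q - 2 * B) * x$3 = 0"
    and eq2: "- 2 * l * Q * x$1 + (l - 1) * x$2 + 2 * a * x$3 = 0"
    and eq3: "- 2 * l * b * x$1 - 2 * A * x$2 + (l - 1 + 4 * a * A) * x$3 = 0"
    by (simp_all add: M_def matrix_vector_mult_def sum_3)
  \<comment> \<open>Applying the first reflection, \<open>word_B c1 c2 c3 z = l *s z\<close> becomes
    an equation between the second reflection after the third, applied to \<open>z\<close>, and
    \<open>l\<close> times the first; collecting the multiples of \<open>z\<close> gives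
    \<open>(1 + l) *s z = y\<close>.\<close>
  define y where "y = (2 * l * x$1) *s c1 + (2 * x$2 - 4 * a * x$3) *s c2 + (2 * x$3) *s c3"
  define z where "z = (1 / (1 + l)) *s y"
  have l': "1 + l \<noteq> 0" using l by (metis add_eq_0_iff)
  have "herm y c1 = (1 + l) * x$1"
    unfolding y_def by (simp add: herm_linear c1 flip: h) (use eq1 in algebra)
  then have z1: "herm z c1 = x$1" using l' by (simp add: z_def herm_linear)
  have "herm y c2 = (1 + l) * x$2"
    unfolding y_def by (simp add: herm_linear c2 flip: h) (use eq2 in algebra)
  then have z2: "herm z c2 = x$2" using l' by (simp add: z_def herm_linear)
  have "herm y c3 = (1 + l) * x$3"
    unfolding y_def by (simp add: herm_linear c3 flip: h) (use eq3 in algebra)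
  then have z3: "herm z c3 = x$3" using l' by (simp add: z_def herm_linear)
  have "z \<noteq> 0"
  proof
    assume "z = 0"
    then have "x$1 = 0 \<and> x$2 = 0 \<and> x$3 = 0" using z1 z2 z3 by (simp add: herm_linear)
    then show False using x(1) by (simp add: vec_eq_iff forall_3)
  qed
  have yz: "y = (1 + l) *s z" using l' by (simp add: z_def)
  have "complex_reflection c2 (complex_reflection c3 z) =
      z - (y - (2 * l * x$1) *s c1)"
    unfolding y_def complex_reflection_def
    by (simp add: herm_linear z2 z3 c2 vec_eq_iff algebra_simps flip: a_def)
  also have "\<dots> = l *s complex_reflection c1 z"
    unfolding yz by (simp add: complex_reflection_def z1 vec_eq_iff algebra_simps)
  finally have "word_B c1 c2 c3 z = complex_reflection c1 (l *s complex_reflection c1 z)"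
    by (simp add: word_B_def)
  then have "word_B c1 c2 c3 z = l *s z"
    by (simp add: complex_reflection_linear complex_reflection_involution[OF c1])
  then show ?thesis using \<open>z \<noteq> 0\<close> that by blast
qed

text \<open>Eigenvectors for distinct unimodular eigenvalues are orthogonal, so the form is diagonal in
  the basis they form; it is indefinite, hence one of them is negative.\<close>

lemma exists_negative_eigenvector:
  assumes iso: "\<And>x y. herm (f x) (f y) = herm x y"
    and add: "\<And>x y. f (x + y) = f x + f y" and scale: "\<And>k x. f (k *s x) = k *s f x"
    and z: "f z1 = a *s z1" "f z2 = b *s z2" "f z3 = c *s z3" "z1 \<noteq> 0" "z2 \<noteq> 0" "z3 \<noteq> 0"
    and unit: "cmod a = 1" "cmod b = 1" "cmod c = 1" and dist: "a \<noteq> b" "a \<noteq> c" "b \<noteq> c"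
  shows "Re (herm z1 z1) < 0 \<or> Re (herm z2 z2) < 0 \<or> Re (herm z3 z3) < 0"
proof (rule ccontr)
  assume "\<not> ?thesis"
  then have n: "Re (herm z1 z1) \<ge> 0" "Re (herm z2 z2) \<ge> 0" "Re (herm z3 z3) \<ge> 0" by auto
  have orth: "herm x y = 0" if "f x = k *s x" "f y = l *s y" "cmod l = 1" "k \<noteq> l" for x y k l
  proof (rule ccontr)
    assume "herm x y \<noteq> 0"
    then have kl: "k * cnj l = 1" using isometry_eigenvalues[of f, OF iso that(1,2)] by blast
    have "l * cnj l = 1" using that(3) by (simp add: mult_cnj_cmod)
    then have "k = l" using kl by algebra
    then show False using that by simp
  qed
  have o: "herm z1 z2 = 0" "herm z1 z3 = 0" "herm z2 z1 = 0" "herm z2 z3 = 0"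
      "herm z3 z1 = 0" "herm z3 z2 = 0"
    using orth z unit dist by metis+
  define M :: "complex^3^3" where "M = vector [z1, z2, z3]"
  \<comment> \<open>\<open>N\<close> is the conjugate transpose of \<open>M\<close> with the sign of
    the form inserted, so \<open>M ** N\<close> is the Gram matrix and its determinant is
    \<open>- |det M|^2\<close>.\<close>
  define N :: "complex^3^3" where "N = vector [vector [cnj (z1$1), cnj (z2$1), cnj (z3$1)],
     vector [cnj (z1$2), cnj (z2$2), cnj (z3$2)], vector [- cnj (z1$3), - cnj (z2$3), - cnj (z3$3)]]"
  have detN: "det N = - cnj (det M)" by (simp add: M_def N_def det_3 algebra_simps)
  have "M ** N = vector [vector [herm z1 z1, herm z1 z2, herm z1 z3],
      vector [herm z2 z1, herm z2 z2, herm z2 z3], vector [herm z3 z1, herm z3 z2, herm z3 z3]]"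
    by (simp add: M_def N_def matrix_matrix_mult_def vec_eq_iff forall_3 sum_3 herm_def)
  then have "det (M ** N) = herm z1 z1 * herm z2 z2 * herm z3 z3"
    by (simp add: det_3 o)
  then have "- (det M * cnj (det M)) = herm z1 z1 * herm z2 z2 * herm z3 z3"
    by (simp add: det_mul detN)
  also have "\<dots> = of_real (Re (herm z1 z1) * Re (herm z2 z2) * Re (herm z3 z3))"
    using herm_self by simp
  finally have "complex_of_real (- (cmod (det M))\<^sup>2) =
      of_real (Re (herm z1 z1) * Re (herm z2 z2) * Re (herm z3 z3))"
    by (simp add: mult_cnj_cmod)
  \<comment> \<open>Three nonnegative diagonal entries force \<open>det M = 0\<close>, that is, a
    linear relation between the eigenvectors; the rest refutes it.\<close>
  then have "- (cmod (det M))\<^sup>2 \<ge> 0" unfolding of_real_eq_iff using n by simp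
  then have "det (transpose M) = 0" by (simp add: det_transpose)
  then obtain x where x: "x \<noteq> 0" "transpose M *v x = 0" by (rule exists_kernel_vector)
  have "x$1 *s z1 + x$2 *s z2 + x$3 *s z3 = transpose M *v x"
    by (simp add: M_def matrix_vector_mult_def transpose_def vec_eq_iff sum_3)
  then have s1: "x$1 *s z1 + x$2 *s z2 + x$3 *s z3 = 0" using x by simp
  have f0: "f 0 = 0" using scale[of 0 0] by simp
  \<comment> \<open>Applying \<open>f\<close> twice produces a Vandermonde system, which distinct
    eigenvalues make uniquely solvable.\<close>
  have s2: "(x$1 * a) *s z1 + (x$2 * b) *s z2 + (x$3 * c) *s z3 = 0"
    using arg_cong[OF s1, of f] by (simp add: add scale z f0)
  have s3: "(x$1 * a * a) *s z1 + (x$2 * b * b) *s z2 + (x$3 * c * c) *s z3 = 0"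
    using arg_cong[OF s2, of f] by (simp add: add scale z f0)
  have "x$1 * z1$i = 0 \<and> x$2 * z2$i = 0 \<and> x$3 * z3$i = 0" for i
  proof -
    have e: "x$1 * z1$i + x$2 * z2$i + x$3 * z3$i = 0"
        "x$1 * a * z1$i + x$2 * b * z2$i + x$3 * c * z3$i = 0"
        "x$1 * a * a * z1$i + x$2 * b * b * z2$i + x$3 * c * c * z3$i = 0"
      using arg_cong[OF s1, of "\<lambda>v. v$i"] arg_cong[OF s2, of "\<lambda>v. v$i"]
        arg_cong[OF s3, of "\<lambda>v. v$i"] by simp_all
    have "(a - b) * (a - c) * (x$1 * z1$i) = 0" "(b - a) * (b - c) * (x$2 * z2$i) = 0"
        "(c - a) * (c - b) * (x$3 * z3$i) = 0"
      using e by algebra+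
    then show ?thesis using dist by simp
  qed
  then have "x$1 *s z1 = 0" "x$2 *s z2 = 0" "x$3 *s z3 = 0" by (simp_all add: vec_eq_iff)
  then have "x = 0" using z by (simp only: vec.scale_eq_0_iff simp_thms vec_eq_iff[of x] forall_3 zero_index)
  then show False using x by simp
qed

lemma elliptic_word_B:
  assumes c1: "herm c1 c1 = 1" and c2: "herm c2 c2 = 1" and c3: "herm c3 c3 = 1"
    and t: "\<tau> = 3 - 4 * (herm c3 c2 * herm c2 c3 + herm c1 c3 * herm c3 c1 + herm c2 c1 * herm c1 c2)
          + 8 * (herm c3 c2 * herm c1 c3 * herm c2 c1)"
    and neg: "goldman_discriminant \<tau> < 0" and re: "Re \<tau> \<noteq> -1"
  shows "elliptic (word_B c1 c2 c3)"
proof -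
  obtain a b c where r: "a + b + c = \<tau>" "a * b + a * c + b * c = cnj \<tau>" "a * b * c = 1"
    by (rule self_dual_cubic_roots)
  have "(a - b) * (a - c) * (b - c) \<noteq> 0"
  proof
    assume "(a - b) * (a - c) * (b - c) = 0"
    then have "((a - b) * (a - c) * (b - c))\<^sup>2 = of_real 0" by (simp only: power_zero_numeral of_real_0)
    then have "goldman_discriminant \<tau> = 0"
      unfolding goldman_discriminant_roots[OF r] of_real_eq_iff .
    then show False using neg by simp
  qed
  then have dist: "a \<noteq> b" "a \<noteq> c" "b \<noteq> c" by auto
  have "b + c + a = \<tau>" "b * c + b * a + c * a = cnj \<tau>" "b * c * a = 1"
      "c + a + b = \<tau>" "c * a + c * b + a * b = cnj \<tau>" "c * a * b = 1"
    using r by (simp_all add: ac_simps)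
  then have unit: "cmod a = 1" "cmod b = 1" "cmod c = 1"
    using root_unimodular neg r by metis+
  have "l ^ 3 - \<tau> * l\<^sup>2 + cnj \<tau> * l - 1 = (l - a) * (l - b) * (l - c)" for l
  proof -
    have "(l - a) * (l - b) * (l - c) =
        l ^ 3 - (a + b + c) * l\<^sup>2 + (a * b + a * c + b * c) * l - a * b * c"
      by algebra
    then show ?thesis unfolding r by simp
  qed
  then have root: "l ^ 3 - \<tau> * l\<^sup>2 + cnj \<tau> * l - 1 = 0" if "l \<in> {a, b, c}" for l
    using that by auto
  \<comment> \<open>The characteristic polynomial takes the value \<open>-2 - 2 * Re \<tau>\<close>
    at -1.\<close>
  have "l \<noteq> -1" if "l \<in> {a, b, c}" for l
  proof
    assume "l = -1"
    then have "- 2 - (\<tau> + cnj \<tau>) = 0" using root[OF that] by algebra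
    then have "Re (- 2 - (\<tau> + cnj \<tau>)) = 0" by (simp only: zero_complex.sel)
    then show False using re by simp
  qed
  then have ev: "\<exists>z. z \<noteq> 0 \<and> word_B c1 c2 c3 z = l *s z" if "l \<in> {a, b, c}" for l
    using word_B_eigenvector[OF c1 c2 c3 t root] that by metis
  obtain z1 where z1: "z1 \<noteq> 0" "word_B c1 c2 c3 z1 = a *s z1" using ev[of a] by blast
  obtain z2 where z2: "z2 \<noteq> 0" "word_B c1 c2 c3 z2 = b *s z2" using ev[of b] by blast
  obtain z3 where z3: "z3 \<noteq> 0" "word_B c1 c2 c3 z3 = c *s z3" using ev[of c] by blast
  have "a \<noteq> 0" "b \<noteq> 0" "c \<noteq> 0" using r(3) by auto
  then show ?thesis
    using exists_negative_eigenvector[of "word_B c1 c2 c3",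
        OF herm_word_B[OF c1 c2 c3] word_B_add word_B_scale z1(2) z2(2) z3(2) z1(1) z2(1) z3(1) unit dist]
      eigenvector_imp_elliptic[of "word_B c1 c2 c3", OF word_B_scale] z1(2) z2(2) z3(2)
    by blast
qed

section \<open>The discriminant along the family of triangles\<close>

text \<open>The traces lie on a circle, where \<open>Re \<tau> = -1 - 8 * x\<close> and
  \<open>(Im \<tau>)^2 = 64 * x * (2 * R - x)\<close>, so the discriminant is a polynomial in
  \<open>x\<close>. At \<open>x = 0\<close> the cubic is \<open>(X - 1) (X + 1)^2\<close>, whence
  the factor \<open>x\<close>.\<close>

lemma goldman_discriminant_circle:
  assumes "\<tau> = -1 - 8 * of_real R + 8 * of_real R * cis \<theta>" and "x = R * (1 - cos \<theta>)"
  shows "goldman_discriminant \<tau> =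
    256 * x * (64 * x\<^sup>2 + (64 * R\<^sup>2 - 80 * R + 13) * x + 2 * (1 - R))"
proof -
  define X Y where "X = Re \<tau>" and "Y = Im \<tau>"
  have X: "X = -1 - 8 * x" unfolding X_def assms by (simp add: algebra_simps)
  have "Y\<^sup>2 = 64 * R\<^sup>2 * (sin \<theta>)\<^sup>2" using assms by (simp add: Y_def power_mult_distrib)
  also have "\<dots> = 64 * R\<^sup>2 * (1 - (cos \<theta>)\<^sup>2)" by (simp only: sin_squared_eq)
  also have "\<dots> = 64 * (R * (1 - cos \<theta>)) * (2 * R - R * (1 - cos \<theta>))" by algebra
  finally have Y: "Y\<^sup>2 = 64 * x * (2 * R - x)" by (simp only: assms(2))
  have "Re (\<tau> ^ 3) = X ^ 3 - 3 * X * Y\<^sup>2"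
    by (simp add: X_def Y_def power3_eq_cube power2_eq_square algebra_simps)
  moreover have "(cmod \<tau>)\<^sup>2 = X\<^sup>2 + Y\<^sup>2" by (simp add: X_def Y_def cmod_power2)
  moreover have "(cmod \<tau>) ^ 4 = ((cmod \<tau>)\<^sup>2)\<^sup>2" by simp
  ultimately have "goldman_discriminant \<tau> =
      (X\<^sup>2 + Y\<^sup>2)\<^sup>2 - 8 * (X ^ 3 - 3 * X * Y\<^sup>2) + 18 * (X\<^sup>2 + Y\<^sup>2) - 27"
    by (simp add: goldman_discriminant_def)
  then show ?thesis unfolding Y X
    by (simp add: power2_eq_square power3_eq_cube algebra_simps)
qed

text \<open>At \<open>x = R (1 - R)\<close> the quadratic equals \<open>(1 - R) (2 + 13 R - 16 R^2)\<close>, which is where the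
  bound on \<open>R\<close> comes from; in the boundary case its other root is \<open>1 / (32 R)\<close>.\<close>

lemma discriminant_quadratic_negative:
  fixes R x :: real
  assumes R: "R \<ge> (13 + sqrt 297) / 32" "R < 1" and x: "x < R * (1 - R)"
  shows "\<exists>y. x \<le> y \<and> 0 < y \<and> y \<le> R * (1 - R) \<and>
    64 * y\<^sup>2 + (64 * R\<^sup>2 - 80 * R + 13) * y + 2 * (1 - R) < 0"
proof -
  have "sqrt 297 > 17.23" by (rule real_less_rsqrt) (simp add: power2_eq_square)
  then have R1: "R > 0.944" using R(1) by simp
  have "sqrt 297 \<le> 32 * R - 13" using R(1) by simp
  then have "297 \<le> (32 * R - 13)\<^sup>2" using real_sqrt_le_iff sqrt_le_D by blast
  \<comment> \<open>\<open>(13 + sqrt 297) / 32\<close> is the positive zero of this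
    quadratic.\<close>
  then have q: "16 * R\<^sup>2 - 13 * R - 2 \<ge> 0" by (simp add: power2_eq_square algebra_simps)
  have x0: "0 < R * (1 - R)" using R1 R(2) by simp
  show ?thesis
  proof (cases "16 * R\<^sup>2 - 13 * R - 2 = 0")
    case False
    then have "(1 - R) * (16 * R\<^sup>2 - 13 * R - 2) > 0" using q R(2) by simp
    moreover have "64 * (R * (1 - R))\<^sup>2 + (64 * R\<^sup>2 - 80 * R + 13) * (R * (1 - R)) + 2 * (1 - R)
        = - ((1 - R) * (16 * R\<^sup>2 - 13 * R - 2))"
      by (simp add: power2_eq_square algebra_simps)
    ultimately show ?thesis using x x0 by (intro exI[of _ "R * (1 - R)"]) simp
  next
    case True
    \<comment> \<open>The zeros of the quadratic in \<open>y\<close> have product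
      \<open>(1 - R) / 32\<close>, and one of them is now \<open>R * (1 - R)\<close>.\<close>
    define u where "u = 1 / (32 * R)"
    have uR: "32 * u * R = 1" using R1 by (simp add: u_def)
    have u0: "u > 0" using R1 by (simp add: u_def)
    \<comment> \<open>Together with \<open>R > 0.944\<close>, this crude bound suffices to place
      \<open>u\<close> below \<open>R * (1 - R)\<close>.\<close>
    have R2: "R < 0.945"
    proof (rule ccontr)
      assume "\<not> R < 0.945"
      then have "R * (16 * R - 13) \<ge> 0.945 * 2.12" by (intro mult_mono) auto
      then show False using True by (simp add: power2_eq_square algebra_simps)
    qed
    have "(13 * R + 2) * (1 - R) \<ge> 14 * (1 / 20)" using R1 R2 by (intro mult_mono) auto
    moreover have "2 * (16 * R\<^sup>2) * (1 - R) = 2 * ((13 * R + 2) * (1 - R))" using True by algebra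
    ultimately have "2 * (16 * R\<^sup>2) * (1 - R) > 1" by linarith
    then have "32 * R * (R * (1 - R)) > 32 * u * R"
      unfolding uR by (simp add: power2_eq_square algebra_simps)
    then have "(32 * R) * (R * (1 - R)) > (32 * R) * u" by (simp add: mult.commute mult.left_commute)
    then have ux: "u < R * (1 - R)" by (rule mult_left_less_imp_less) (use R1 in simp)
    \<comment> \<open>The midpoint lies strictly between the two zeros and not below
      \<open>x\<close>.\<close>
    define y where "y = (max x u + R * (1 - R)) / 2"
    have y: "x \<le> y" "u < y" "y < R * (1 - R)" using x ux by (auto simp: y_def max_def)
    have "64 * y\<^sup>2 + (64 * R\<^sup>2 - 80 * R + 13) * y + 2 * (1 - R) = 64 * ((y - R * (1 - R)) * (y - u))"
      using True uR by algebra
    also have "\<dots> < 0" using mult_neg_pos[of "y - R * (1 - R)" "y - u"] y by (simp add: mult.commute)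
    finally show ?thesis using y u0 by (intro exI[of _ y]) auto
  qed
qed

section \<open>Construction of triangles\<close>

text \<open>Take \<open>c2\<close> as the first basis vector and \<open>c3\<close> in the plane of
  the first two. The prescribed products determine the first two entries of \<open>c1\<close>, and
  \<open>herm c1 c1 = 1\<close> fixes the modulus of the third.\<close>

lemma exists_polar_vectors:
  fixes r1 r2 r3 \<theta> :: real
  assumes r: "0 < r1" "r1 < 1" "0 < r2" "0 < r3" and th: "cos \<theta> < 1"
    and id: "r1\<^sup>2 + r2\<^sup>2 + r3\<^sup>2 = 1 + 2 * r1 * r2 * r3"
  obtains c1 c2 c3 where "herm c1 c1 = 1" "herm c2 c2 = 1" "herm c3 c3 = 1"
    "herm c3 c2 = of_real r1" "herm c1 c3 = of_real r2" "herm c2 c1 = of_real r3 * cis \<theta>"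
    "\<And>k. c3 \<noteq> k *s c2" "\<And>k. c1 \<noteq> k *s c3" "\<And>k. c2 \<noteq> k *s c1"
proof -
  have "r1\<^sup>2 < 1" using r by (simp add: abs_square_less_1)
  define s where "s = sqrt (1 - r1\<^sup>2)"
  have s: "s > 0" "s\<^sup>2 = 1 - r1\<^sup>2" using \<open>r1\<^sup>2 < 1\<close> by (simp_all add: s_def)
  \<comment> \<open>By \<open>id\<close> the Gram determinant is
    \<open>-2 * r1 * r2 * r3 * (1 - cos \<theta>)\<close>; it must equal
    \<open>- (d * s)^2\<close>.\<close>
  define d where "d = sqrt (2 * (r1 * r2 * r3) * (1 - cos \<theta>)) / s"
  have pos: "2 * (r1 * r2 * r3) * (1 - cos \<theta>) > 0" using r th by simp
  then have d: "d > 0" "d\<^sup>2 * s\<^sup>2 = 2 * (r1 * r2 * r3) * (1 - cos \<theta>)"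
    using s(1) by (simp_all add: d_def power_divide)
  define e where "e = of_real r2 - of_real (r1 * r3) * cis (- \<theta>)"
  define c1 c2 c3 :: "complex^3" where
    "c1 = vector [of_real r3 * cis (- \<theta>), e / of_real s, of_real d]"
    and "c2 = vector [1, 0, 0]" and "c3 = vector [of_real r1, of_real s, 0]"
  have "(cmod e)\<^sup>2 = (r2 - r1 * r3 * cos \<theta>)\<^sup>2 + (r1 * r3 * sin \<theta>)\<^sup>2"
    by (simp add: cmod_power2 e_def)
  also have "\<dots> = r2\<^sup>2 - 2 * r1 * r2 * r3 * cos \<theta> + r1\<^sup>2 * r3\<^sup>2 * ((cos \<theta>)\<^sup>2 + (sin \<theta>)\<^sup>2)"
    by algebra
  finally have e: "(cmod e)\<^sup>2 = r2\<^sup>2 - 2 * r1 * r2 * r3 * cos \<theta> + r1\<^sup>2 * r3\<^sup>2" by simp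
  have "Re (herm c1 c1) = r3\<^sup>2 + (cmod e)\<^sup>2 / s\<^sup>2 - d\<^sup>2"
    by (simp add: Re_herm_self c1_def norm_mult norm_divide power_divide power_mult_distrib)
  then have "s\<^sup>2 * Re (herm c1 c1) = r3\<^sup>2 * s\<^sup>2 + (cmod e)\<^sup>2 - d\<^sup>2 * s\<^sup>2"
    using s(1) by (simp add: field_simps)
  also have "\<dots> = s\<^sup>2 * 1" unfolding e d(2) unfolding s(2) using id by algebra
  finally have "Re (herm c1 c1) = 1" using s(1) by simp
  then have 1: "herm c1 c1 = 1" using herm_self[of c1] by simp
  have 2: "herm c2 c2 = 1" by (simp add: c2_def herm_def)
  have "complex_of_real (r1\<^sup>2 + s\<^sup>2) = 1" unfolding s(2) by simp
  then have 3: "herm c3 c3 = 1" by (simp add: c3_def herm_def power2_eq_square)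
  have 4: "herm c3 c2 = of_real r1" by (simp add: c2_def c3_def herm_def)
  have 5: "herm c1 c3 = of_real r2" using s(1) by (simp add: c1_def c3_def e_def herm_def)
  have 6: "herm c2 c1 = of_real r3 * cis \<theta>" by (simp add: c1_def c2_def herm_def cis_cnj)
  have 7: "c3 \<noteq> k *s c2" for k
  proof
    assume k: "c3 = k *s c2"
    show False using arg_cong[OF k, of "\<lambda>v. v$2"] s(1) by (simp add: c2_def c3_def)
  qed
  have 8: "c1 \<noteq> k *s c3" for k
  proof
    assume k: "c1 = k *s c3"
    show False using arg_cong[OF k, of "\<lambda>v. v$3"] d(1) by (simp add: c1_def c3_def)
  qed
  have 9: "c2 \<noteq> k *s c1" for k
  proof
    assume k: "c2 = k *s c1"
    have "k = 0" using arg_cong[OF k, of "\<lambda>v. v$3"] d(1) by (simp add: c1_def c2_def)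
    then show False using 2 k by (simp add: herm_linear)
  qed
  show ?thesis using that 1 2 3 4 5 6 7 8 9 by blast
qed

section \<open>The angles pi/p and their cosines\<close>

lemma pi_over_bounds:
  assumes "3 \<le> p" shows "0 \<le> pi_over p" "pi_over p \<le> pi / 3"
proof -
  have "0 \<le> pi_over p \<and> pi_over p \<le> pi / 3"
  proof (cases p)
    case (enat n)
    then have "3 \<le> n" using assms by (simp add: numeral_eq_enat)
    then have "pi / real n \<le> pi / 3" by (intro frac_le) auto
    then show ?thesis unfolding pi_over_def enat by simp
  qed (simp add: pi_over_def)
  then show "0 \<le> pi_over p" "pi_over p \<le> pi / 3" by auto
qed

lemma cos_pi_over_bounds:
  assumes "3 \<le> p" shows "0 < cos_pi_over p" "cos_pi_over p \<le> 1"
proof -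
  have "pi / 3 < pi / 2" by simp
  then show "0 < cos_pi_over p"
    unfolding cos_pi_over_def using pi_over_bounds[OF assms] by (intro cos_gt_zero_pi) linarith+
qed (simp add: cos_pi_over_def)

lemma pi_over_antimono:
  assumes "3 \<le> p" "p \<le> q" shows "pi_over q \<le> pi_over p"
proof (cases q)
  case q: (enat n)
  then obtain m where p: "p = enat m" using assms by (cases p) auto
  then have "3 \<le> m" "m \<le> n" using assms q by (auto simp: numeral_eq_enat)
  then have "pi / real n \<le> pi / real m" by (intro frac_le) auto
  then show ?thesis by (simp add: p q pi_over_def)
next
  case infinity
  then show ?thesis using pi_over_bounds[OF assms(1)] by (simp add: pi_over_def)
qed

lemma cos_pi_over_mono:
  assumes "3 \<le> p" "p \<le> q" shows "cos_pi_over p \<le> cos_pi_over q"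
  unfolding cos_pi_over_def
  using pi_over_antimono[OF assms] pi_over_bounds[OF assms(1)] pi_over_bounds[of q] assms
  by (intro cos_monotone_0_pi_le) auto

text \<open>The identity gives \<open>c_inf = 1\<close>, so every real t is admissible and every
  angular invariant in (0, pi] is realised; pi gives t = 0.\<close>

lemma triangle_with_parameterI:
  assumes p: "3 \<le> p1" "3 \<le> p2" "3 \<le> p3" and r1: "cos_pi_over p1 < 1"
    and id: "(cos_pi_over p1)\<^sup>2 + (cos_pi_over p2)\<^sup>2 + (cos_pi_over p3)\<^sup>2 =
      1 + 2 * cos_pi_over p1 * cos_pi_over p2 * cos_pi_over p3"
    and th: "0 < \<theta>" "\<theta> \<le> pi"
  obtains c1 c2 c3 where "triangle_with_parameter p1 p2 p3 (cot (\<theta> / 2)) c1 c2 c3"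
    "herm c1 c1 = 1" "herm c2 c2 = 1" "herm c3 c3 = 1"
    "herm c3 c2 = of_real (cos_pi_over p1)" "herm c1 c3 = of_real (cos_pi_over p2)"
    "herm c2 c1 = of_real (cos_pi_over p3) * cis \<theta>"
proof -
  define r1 r2 r3 where "r1 = cos_pi_over p1" and "r2 = cos_pi_over p2" and "r3 = cos_pi_over p3"
  note rs = r1_def r2_def r3_def
  have r: "0 < r1" "r1 < 1" "0 < r2" "0 < r3"
    using cos_pi_over_bounds p r1 by (auto simp: rs)
  have id': "r1\<^sup>2 + r2\<^sup>2 + r3\<^sup>2 = 1 + 2 * r1 * r2 * r3" using id by (simp add: rs)
  have "cos \<theta> < cos 0" using th by (intro cos_monotone_0_pi) auto
  then have cth: "cos \<theta> < 1" by simp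
  obtain c1 c2 c3 where c: "herm c1 c1 = 1" "herm c2 c2 = 1" "herm c3 c3 = 1"
      and h: "herm c3 c2 = of_real r1" "herm c1 c3 = of_real r2" "herm c2 c1 = of_real r3 * cis \<theta>"
      and ne: "\<And>k. c3 \<noteq> k *s c2" "\<And>k. c1 \<noteq> k *s c3" "\<And>k. c2 \<noteq> k *s c1"
    using exists_polar_vectors[OF r cth id'] by metis
  define C where "C c = {L \<in> complex_hyperbolic_plane. \<forall>z\<in>L. herm z c = 0}" for c
  have C: "normalised_polar_vector (C c) c" if "herm c c = 1" for c
    using that by (simp add: normalised_polar_vector_def polar_vector_def C_def)
  note Cs = C[OF c(1)] C[OF c(2)] C[OF c(3)]
  have pb: "0 \<le> pi_over p" "pi_over p \<le> pi / 2" if "3 \<le> p" for p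
    using pi_over_bounds[OF that] pi_gt_zero by linarith+
  have hc: "cmod (herm c3 c2) = cos (pi_over p1)" "cmod (herm c1 c3) = cos (pi_over p2)"
    "cmod (herm c2 c1) = cos (pi_over p3)"
    using r by (simp_all add: h norm_mult) (simp_all add: rs cos_pi_over_def)
  have "complex_geodesic (C c1)" "complex_geodesic (C c2)" "complex_geodesic (C c3)"
    using Cs by (auto simp: complex_geodesic_def normalised_polar_vector_def)
  then have "triangle p1 p2 p3 (C c1) (C c2) (C c3)"
    unfolding triangle_def
    using meet_at_angleI[OF Cs(3,2) hc(1) pb[OF p(1)] ne(1)]
      meet_at_angleI[OF Cs(1,3) hc(2) pb[OF p(2)] ne(2)]
      meet_at_angleI[OF Cs(2,1) hc(3) pb[OF p(3)] ne(3)]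
    by blast
  moreover have "angular_invariant c1 c2 c3 = \<theta>"
  proof -
    have "herm c3 c2 * herm c1 c3 * herm c2 c1 = rcis (r1 * r2 * r3) \<theta>"
      by (simp add: h rcis_def)
    moreover have "- pi < \<theta>" using th(1) pi_gt_zero by linarith
    ultimately show ?thesis using th r by (simp add: angular_invariant_def Arg_rcis)
  qed
  moreover have "t_inf p1 p2 p3 = \<infinity>"
  proof -
    have "c_inf p1 p2 p3 = 1" using id' r by (simp add: c_inf_def flip: rs)
    then show ?thesis by (simp add: t_inf_def)
  qed
  ultimately have "triangle_with_parameter p1 p2 p3 (cot (\<theta> / 2)) c1 c2 c3"
    unfolding triangle_with_parameter_def using Cs th by auto
  then show ?thesis using that c h by (simp add: rs)
qed

section \<open>Comparison of the two words\<close>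

text \<open>Turns a larger angular invariant into a smaller t. The endpoint pi/2, where
  \<open>cot\<close> is 0, is the real triangle.\<close>

lemma cot_antimono:
  assumes "0 < x" "x \<le> y" "y \<le> pi / 2" shows "cot y \<le> cot x"
  unfolding cot_def
proof (rule frac_le)
  show "0 \<le> cos x" using assms by (intro cos_ge_zero) auto
  show "cos y \<le> cos x" using assms by (intro cos_monotone_0_pi_le) auto
  show "0 < sin x" using assms pi_gt_zero by (intro sin_gt_zero) linarith+
  show "sin x \<le> sin y" using assms by (intro sin_monotone_2pi_le) auto
qed

text \<open>Each parameter with the first word elliptic is matched with one that is no larger and
  makes the second word elliptic. This compares the infima, also when the first set is
  empty.\<close>

lemma type_B_of_product_bound:
  assumes p: "3 \<le> p1" "p1 \<le> p2" "p2 \<le> p3"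
    and id: "(cos_pi_over p1)\<^sup>2 + (cos_pi_over p2)\<^sup>2 + (cos_pi_over p3)\<^sup>2 =
      1 + 2 * cos_pi_over p1 * cos_pi_over p2 * cos_pi_over p3"
    and bound: "cos_pi_over p1 * cos_pi_over p2 * cos_pi_over p3 \<ge> (13 + sqrt 297) / 32"
  shows "type_B p1 p2 p3"
proof -
  have p': "3 \<le> p1" "3 \<le> p2" "3 \<le> p3" using p by auto
  define r1 r2 r3 R where "r1 = cos_pi_over p1" and "r2 = cos_pi_over p2" and "r3 = cos_pi_over p3"
    and "R = r1 * r2 * r3"
  note rs = r1_def r2_def r3_def
  have r0: "0 < r1" "0 < r2" "0 < r3" and r1: "r1 \<le> 1" "r2 \<le> 1" "r3 \<le> 1"
    using cos_pi_over_bounds p' by (auto simp: rs)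
  have r12: "r1 \<le> r2" "r2 \<le> r3" using cos_pi_over_mono p p' by (auto simp: rs)
  have R0: "R > 0" using r0 by (simp add: R_def)
  have idR: "r1\<^sup>2 + r2\<^sup>2 + r3\<^sup>2 = 1 + 2 * R" using id by (simp add: rs R_def)
  have boundR: "R \<ge> (13 + sqrt 297) / 32" using bound by (simp add: rs R_def)
  have "\<exists>t'\<in>elliptic_parameters p1 p2 p3 word_B. t' \<le> t"
    if tA: "t \<in> elliptic_parameters p1 p2 p3 word_A" for t
  proof -
    obtain c1 c2 c3 where t: "t \<ge> 0" and tri: "triangle_with_parameter p1 p2 p3 t c1 c2 c3"
        and ell: "elliptic (word_A c1 c2 c3)"
      using tA by (auto simp: elliptic_parameters_def)
    obtain C1 C2 C3 where C: "triangle p1 p2 p3 C1 C2 C3" "normalised_polar_vector C1 c1"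
        "normalised_polar_vector C2 c2" "normalised_polar_vector C3 c3"
      using tri by (auto simp: triangle_with_parameter_def)
    have u: "herm c1 c1 = 1" "herm c2 c2 = 1" "herm c3 c3 = 1"
      using C by (auto simp: normalised_polar_vector_def)
    have h: "cmod (herm c3 c2) = r1" "cmod (herm c1 c3) = r2" "cmod (herm c2 c1) = r3"
      using C meet_at_angle_imp_cmod_herm unfolding rs cos_pi_over_def triangle_def by blast+
    define H \<beta> where "H = herm c3 c2 * herm c1 c3 * herm c2 c1" and "\<beta> = Arg H"
    have tb: "\<beta> \<noteq> 0" "t = cot (\<beta> / 2)"
      using tri by (auto simp: triangle_with_parameter_def angular_invariant_def \<beta>_def H_def)
    have "cmod H = R" by (simp add: H_def norm_mult h R_def)
    then have H: "Re H = R * cos \<beta>"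
      using rcis_cmod_Arg[of H] by (metis Re_rcis \<beta>_def)
    have bb: "- pi < \<beta>" "\<beta> \<le> pi" using Arg_bounded[of H] by (auto simp: \<beta>_def)
    \<comment> \<open>A negative invariant would lie in (-pi, 0), where
      \<open>cot (\<beta> / 2)\<close> is negative, against \<open>t \<ge> 0\<close>.\<close>
    have b0: "0 < \<beta>"
    proof (rule ccontr)
      assume "\<not> 0 < \<beta>"
      then have "0 < - (\<beta> / 2)" "- (\<beta> / 2) < pi / 2" using tb bb by auto
      then have "sin (- (\<beta> / 2)) > 0" "cos (- (\<beta> / 2)) > 0"
        using sin_gt_zero2 cos_gt_zero by blast+
      then have "cot (\<beta> / 2) < 0" by (simp add: cot_def divide_pos_neg)
      then show False using t tb by simp
    qed
    then have "cos \<beta> < cos 0" using bb by (intro cos_monotone_0_pi) auto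
    then have cb: "cos \<beta> < 1" by simp
    define x where "x = R * (1 - cos \<beta>)"
    have x0: "x > 0" using cb R0 by (simp add: x_def)
    \<comment> \<open>By \<open>idR\<close> this says that the Gram determinant of the polar vectors
      is not zero.\<close>
    have "R * cos \<beta> < R" using cb R0 by simp
    then have "1 + 2 * Re H \<noteq> r1\<^sup>2 + r2\<^sup>2 + r3\<^sup>2" unfolding idR H by linarith
    then have "r3\<^sup>2 + 4 * r1\<^sup>2 * r2\<^sup>2 - 4 * Re H < 1"
      using elliptic_word_A[OF u ell] by (simp add: h flip: H_def)
    then have xA: "4 * x < 1 - r3\<^sup>2 + 4 * R - 4 * (r1\<^sup>2 * r2\<^sup>2)"
      by (simp add: H x_def algebra_simps)
    \<comment> \<open>The bound \<open>xA\<close> still involves the single cosines. Since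
      \<open>4 * (r1 * r2)^2 \<ge> 1\<close>, replacing \<open>1 - r3^2\<close> by
      \<open>4 * (r1 * r2)^2 * (1 - r3^2)\<close> leaves an estimate in \<open>R\<close>
      alone.\<close>
    have "R \<le> r1 * r2" using r0 r1 by (simp add: R_def mult_left_le)
    moreover have "sqrt 297 \<ge> 3" by (rule real_le_rsqrt) simp
    ultimately have "1 / 2 \<le> r1 * r2" using boundR by simp
    then have "(1 / 2)\<^sup>2 \<le> (r1 * r2)\<^sup>2" by (intro power_mono) auto
    then have "1 \<le> 4 * (r1\<^sup>2 * r2\<^sup>2)" by (simp add: power2_eq_square algebra_simps)
    moreover have "r3\<^sup>2 \<le> 1" using r0 r1 by (simp add: abs_square_le_1)
    ultimately have "1 * (1 - r3\<^sup>2) \<le> 4 * (r1\<^sup>2 * r2\<^sup>2) * (1 - r3\<^sup>2)"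
      by (intro mult_right_mono) auto
    then have "1 - r3\<^sup>2 - 4 * (r1\<^sup>2 * r2\<^sup>2) \<le> - 4 * R\<^sup>2"
      by (simp add: R_def power_mult_distrib algebra_simps)
    then have x1: "x < R * (1 - R)" using xA by (simp add: power2_eq_square algebra_simps)
    have R1: "R < 1"
    proof (rule ccontr)
      assume "\<not> R < 1"
      then have "R * (1 - R) \<le> 0" using R0 by (simp add: mult_nonneg_nonpos)
      then show False using x0 x1 by simp
    qed
    obtain y where y: "x \<le> y" "0 < y" "y \<le> R * (1 - R)"
        "64 * y\<^sup>2 + (64 * R\<^sup>2 - 80 * R + 13) * y + 2 * (1 - R) < 0"
      using discriminant_quadratic_negative[OF boundR R1 x1] by blast
    \<comment> \<open>This puts \<open>1 - y / R\<close> into the domain of \<open>arccos\<close>,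
      so that \<open>y\<close> comes from an angular invariant \<open>\<alpha>\<close>.\<close>
    have "R * (1 - R) < R" using R0 by (simp add: algebra_simps)
    then have "y < 2 * R" using y(3) R0 by linarith
    then have yR: "- 1 \<le> 1 - y / R" "1 - y / R \<le> 1" using y(2) R0 by (auto simp: field_simps)
    define \<alpha> where "\<alpha> = arccos (1 - y / R)"
    have ca: "cos \<alpha> = 1 - y / R" using yR by (simp add: \<alpha>_def)
    have a: "0 \<le> \<alpha>" "\<alpha> \<le> pi" using yR by (simp_all add: \<alpha>_def arccos_lbound arccos_ubound)
    have "\<alpha> \<noteq> 0" using ca y(2) R0 by auto
    then have a0: "0 < \<alpha>" using a by simp
    have yc: "y = R * (1 - cos \<alpha>)" using R0 by (simp add: ca)
    have "cos \<alpha> \<le> cos \<beta>" using y(1) R0 unfolding yc x_def by simp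
    then have ab: "\<beta> \<le> \<alpha>" using cos_mono_le_eq[of \<alpha> \<beta>] a b0 bb by simp
    \<comment> \<open>The construction of polar vectors divides by \<open>sqrt (1 - r1^2)\<close>.
      As \<open>r1\<close> is the smallest cosine, \<open>r1 = 1\<close> would give
      \<open>R = 1\<close>.\<close>
    have "r1 < 1"
    proof (rule ccontr)
      assume "\<not> r1 < 1"
      then have "r1 = 1" "r2 = 1" "r3 = 1" using r1 r12 by auto
      then show False using R1 by (simp add: R_def)
    qed
    then obtain d1 d2 d3 where d: "triangle_with_parameter p1 p2 p3 (cot (\<alpha> / 2)) d1 d2 d3"
        "herm d1 d1 = 1" "herm d2 d2 = 1" "herm d3 d3 = 1"
        "herm d3 d2 = of_real r1" "herm d1 d3 = of_real r2" "herm d2 d1 = of_real r3 * cis \<alpha>"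
      using triangle_with_parameterI[OF p' _ id a0 a(2)] unfolding rs by metis
    \<comment> \<open>This is the trace of the second word after substituting
      \<open>r1^2 + r2^2 + r3^2 = 1 + 2 * R\<close>.\<close>
    define \<tau> where "\<tau> = -1 - 8 * of_real R + 8 * of_real R * cis \<alpha>"
    have "goldman_discriminant \<tau> < 0"
      unfolding goldman_discriminant_circle[OF \<tau>_def yc] using y by (simp add: mult_pos_neg)
    moreover have "Re \<tau> \<noteq> -1"
      using y(2) R0 by (simp add: \<tau>_def ca right_diff_distrib)
    moreover have "\<tau> = 3 - 4 * (herm d3 d2 * herm d2 d3 + herm d1 d3 * herm d3 d1
        + herm d2 d1 * herm d1 d2) + 8 * (herm d3 d2 * herm d1 d3 * herm d2 d1)"
    proof -
      have "herm d3 d2 * herm d2 d3 = of_real (r1\<^sup>2)" "herm d1 d3 * herm d3 d1 = of_real (r2\<^sup>2)"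
        "herm d2 d1 * herm d1 d2 = of_real (r3\<^sup>2)"
        using mult_cnj_cmod[of "herm d3 d2"] mult_cnj_cmod[of "herm d1 d3"]
          mult_cnj_cmod[of "herm d2 d1"] r0 unfolding cnj_herm
        by (simp_all add: d norm_mult)
      then have "herm d3 d2 * herm d2 d3 + herm d1 d3 * herm d3 d1 + herm d2 d1 * herm d1 d2
          = of_real (1 + 2 * R)"
        unfolding idR[symmetric] by simp
      moreover have "herm d3 d2 * herm d1 d3 * herm d2 d1 = of_real R * cis \<alpha>"
        by (simp add: d R_def)
      ultimately show ?thesis by (simp add: \<tau>_def)
    qed
    ultimately have "elliptic (word_B d1 d2 d3)" using elliptic_word_B[OF d(2-4)] by blast
    moreover have "cot (\<alpha> / 2) \<le> t"
      unfolding tb(2) using b0 ab a(2) by (intro cot_antimono) auto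
    moreover have "cot (\<alpha> / 2) \<ge> 0"
      using cot_antimono[of "\<alpha> / 2" "pi / 2"] a0 a(2) by (simp add: cot_def)
    ultimately show ?thesis using d(1) by (auto simp: elliptic_parameters_def)
  qed
  then have "Inf (ereal ` elliptic_parameters p1 p2 p3 word_B) \<le>
      Inf (ereal ` elliptic_parameters p1 p2 p3 word_A)"
    by (intro Inf_mono) force
  then show ?thesis by (simp add: type_B_def type_A_def not_less)
qed

section \<open>The families (p, p, infinity) and (p, 2p, 2p)\<close>

lemma cos_squared_lower_bound: "(cos x)\<^sup>2 \<ge> 1 - x\<^sup>2" for x :: real
proof -
  have "(sin x)\<^sup>2 \<le> x\<^sup>2" using abs_sin_x_le_abs_x[of x] by (simp add: abs_le_square_iff)
  then show ?thesis by (simp add: cos_squared_eq)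
qed

lemma threshold_less: "(13 + sqrt 297) / 32 < (0.945 :: real)"
proof -
  have "sqrt 297 < 17.24" by (rule real_less_lsqrt) (simp_all add: power2_eq_square)
  then show ?thesis by simp
qed

lemma pi_over_le:
  assumes "enat n \<le> p" "3 \<le> n" shows "pi_over p \<le> 3.2 / real n"
proof -
  have "pi_over p \<le> pi_over (enat n)"
    by (rule pi_over_antimono) (use assms in \<open>auto simp: numeral_eq_enat\<close>)
  also have "\<dots> = pi / real n" by (simp add: pi_over_def)
  also have "\<dots> \<le> 3.2 / real n" by (rule divide_right_mono) (use pi_approx in auto)
  finally show ?thesis .
qed

text \<open>With \<open>r3 = 1\<close> both sides of the identity are \<open>1 + 2 * r1^2\<close>,
  and the product is \<open>cos(pi/p)^2\<close>, which is at least
  \<open>1 - (3.2/14)^2 > 0.945\<close>.\<close>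

lemma type_B_p_p_infinity:
  assumes "14 \<le> p" shows "type_B p p \<infinity>"
proof -
  have p: "3 \<le> p" using assms order_trans[of 3 "14 :: enat" p] by (simp add: numeral_eq_enat)
  have inf: "cos_pi_over \<infinity> = 1" by (simp add: cos_pi_over_def pi_over_def)
  have "pi_over p \<le> 3.2 / 14" using pi_over_le[of 14 p] assms by (simp add: numeral_eq_enat)
  then have "(pi_over p)\<^sup>2 \<le> (3.2 / 14)\<^sup>2" using pi_over_bounds[OF p] by (intro power_mono) auto
  also have "\<dots> \<le> 0.055" by (simp add: power2_eq_square)
  finally have "(pi_over p)\<^sup>2 \<le> 0.055" .
  then have "(cos_pi_over p)\<^sup>2 \<ge> 0.945"
    using cos_squared_lower_bound[of "pi_over p"] by (simp add: cos_pi_over_def)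
  then show ?thesis using threshold_less p
    by (intro type_B_of_product_bound) (auto simp: inf power2_eq_square)
qed

text \<open>With \<open>c = cos(pi/(2p))\<close> the cosines are \<open>2 * c^2 - 1\<close>,
  \<open>c\<close>, \<open>c\<close>, and the identity becomes a polynomial one in \<open>c\<close>.
  The product increases with \<open>c\<close>, and \<open>c^2 \<ge> 0.982\<close> brings it above
  0.945.\<close>

lemma type_B_p_2p_2p:
  assumes "12 \<le> p" shows "type_B p (2 * p) (2 * p)"
proof -
  have p: "3 \<le> p" using assms order_trans[of 3 "12 :: enat" p] by (simp add: numeral_eq_enat)
  have p2: "p \<le> 2 * p" by (cases p) (auto simp: numeral_eq_enat)
  define \<theta> where "\<theta> = pi_over (2 * p)"
  have th: "pi_over p = 2 * \<theta>"
    by (cases p) (auto simp: \<theta>_def pi_over_def numeral_eq_enat)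
  have "pi_over p \<le> 3.2 / 12" using pi_over_le[of 12 p] assms by (simp add: numeral_eq_enat)
  then have "\<theta>\<^sup>2 \<le> (3.2 / 24)\<^sup>2" using pi_over_bounds[OF p] th by (intro power_mono) auto
  also have "\<dots> \<le> 0.018" by (simp add: power2_eq_square)
  finally have c: "(cos \<theta>)\<^sup>2 \<ge> 0.982" using cos_squared_lower_bound[of \<theta>] by simp
  have r1: "cos_pi_over p = 2 * (cos \<theta>)\<^sup>2 - 1" and r2: "cos_pi_over (2 * p) = cos \<theta>"
    by (simp_all add: cos_pi_over_def th cos_double_cos \<theta>_def)
  have "(2 * (cos \<theta>)\<^sup>2 - 1) * (cos \<theta>)\<^sup>2 \<ge> 0.964 * 0.982" using c by (intro mult_mono) auto
  then have "cos_pi_over p * cos_pi_over (2 * p) * cos_pi_over (2 * p) \<ge> (13 + sqrt 297) / 32"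
    using threshold_less unfolding r1 r2 by (simp add: power2_eq_square mult.assoc)
  moreover have "(cos_pi_over p)\<^sup>2 + (cos_pi_over (2 * p))\<^sup>2 + (cos_pi_over (2 * p))\<^sup>2 =
      1 + 2 * cos_pi_over p * cos_pi_over (2 * p) * cos_pi_over (2 * p)"
    unfolding r1 r2 by (simp add: power2_eq_square algebra_simps)
  ultimately show ?thesis using p p2 by (intro type_B_of_product_bound) auto
qed

theorem proposition16:
  shows
    "(\<forall>p1 p2 p3 :: enat.
        3 \<le> p1 \<and> p1 \<le> p2 \<and> p2 \<le> p3 \<and>
        (cos_pi_over p1)\<^sup>2 + (cos_pi_over p2)\<^sup>2 + (cos_pi_over p3)\<^sup>2 =
          1 + 2 * cos_pi_over p1 * cos_pi_over p2 * cos_pi_over p3 \<and>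
        cos_pi_over p1 * cos_pi_over p2 * cos_pi_over p3 \<ge> (13 + sqrt 297) / 32
        \<longrightarrow> type_B p1 p2 p3) \<and>
     (\<forall>p :: enat. 14 \<le> p \<longrightarrow> type_B p p \<infinity>) \<and>
     (\<forall>p :: enat. 12 \<le> p \<longrightarrow> type_B p (2 * p) (2 * p))"
  using type_B_of_product_bound type_B_p_p_infinity type_B_p_2p_2p by blast

end
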